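(* Let $b=(b(n))_{n}$ be a sequence of positive integers with $b(n)=o\big(\alpha(n)/\log n\big)$ as $n\to\infty$. Let $\mathbb{P}_{n,b(n),\alpha}$ be the distribution of $(C_1,\dots,C_{b(n)})$ under $\mathbb{P}_{n,\alpha}$, and let $\tilde{\mathbb{P}}_{b(n)}$ be the distribution of a vector $(Z_1,\dots,Z_{b(n)})$ of independent Poisson distributed random variables, where $Z_j$ has expectation $\frac1j$ for all $j\le b(n)$. Then there exists $c<\infty$ such that for all $n\in\mathbb{N}$, $$\big\|\mathbb{P}_{n,b(n),\alpha}-\tilde{\mathbb{P}}_{b(n)}\big\|_{\rm TV}\le c\left(\frac{\alpha(n)}{n}+b(n)\frac{\log n}{\alpha(n)}\right).$$
   Context: Fix $a_1,a_2\in(0,1)$ and a sequence $\alpha=(\alpha(n))_{n\in\mathbb{N}}$ with $n^{a_1}\le\alpha(n)\le n^{a_2}$. $S_{n,\alpha}$ is the set of permutations of $\{1,\dots,n\}$ all of whose cycles have length at most $\alpha(n)$; $\mathbb{P}_{n,\alpha}$ is the uniform probability measure on $S_{n,\alpha}$. $C_m=C_m(\sigma)$ is the number of cycles of length $m$ in the permutation $\sigma$. For probability measures $\mathbb{P},\tilde{\mathbb{P}}$ on a discrete probability space $\Omega$, $\|\mathbb{P}-\tilde{\mathbb{P}}\|_{\rm TV}=\sum_{\omega\in\Omega}(\mathbb{P}(\omega)-\tilde{\mathbb{P}}(\omega))_+$, where $(\cdot)_+$ denotes the positive part. *)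

theory Defs
  imports
    "HOL-Probability.Probability"
    "HOL-Combinatorics.Orbits"
    "HOL-Library.Landau_Symbols"
begin

(* A fixed point x contributes the singleton orbit {x}, i.e. a cycle of length 1. *)
definition cycles_of_perm :: "nat \<Rightarrow> (nat \<Rightarrow> nat) \<Rightarrow> nat set set" where
  "cycles_of_perm n \<sigma> = orbit \<sigma> ` {1..n}"

definition cycle_count :: "nat \<Rightarrow> nat \<Rightarrow> (nat \<Rightarrow> nat) \<Rightarrow> nat" where
  "cycle_count n m \<sigma> = card {c \<in> cycles_of_perm n \<sigma>. card c = m}"

definition short_cycle_perms :: "nat \<Rightarrow> (nat \<Rightarrow> real) \<Rightarrow> (nat \<Rightarrow> nat) set" where
  "short_cycle_perms n \<alpha> =
     {\<sigma>. \<sigma> permutes {1..n} \<and> (\<forall>c \<in> cycles_of_perm n \<sigma>. real (card c) \<le> \<alpha> n)}"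

definition perm_pmf :: "nat \<Rightarrow> (nat \<Rightarrow> real) \<Rightarrow> (nat \<Rightarrow> nat) pmf" where
  "perm_pmf n \<alpha> = pmf_of_set (short_cycle_perms n \<alpha>)"

(* A vector (v_1, ..., v_b) of natural numbers is encoded as the function m \<mapsto> v_m on {1..b},
   extended by 0; this is also the default value in poisson_vector_pmf. *)
definition cycle_count_pmf :: "nat \<Rightarrow> nat \<Rightarrow> (nat \<Rightarrow> real) \<Rightarrow> (nat \<Rightarrow> nat) pmf" where
  "cycle_count_pmf n b \<alpha> =
     map_pmf (\<lambda>\<sigma> m. if m \<in> {1..b} then cycle_count n m \<sigma> else 0) (perm_pmf n \<alpha>)"

(* The joint law of independent variables is the product of their laws. *)
definition poisson_vector_pmf :: "nat \<Rightarrow> (nat \<Rightarrow> nat) pmf" where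
  "poisson_vector_pmf b = Pi_pmf {1..b} 0 (\<lambda>j. poisson_pmf (1 / real j))"

definition tv_dist :: "'a pmf \<Rightarrow> 'a pmf \<Rightarrow> real" where
  "tv_dist p q = (\<Sum>\<^sub>\<infinity>\<omega>. max 0 (pmf p \<omega> - pmf q \<omega>))"

(* The sum in tv_dist never takes the default value 0 of a divergent infsum, and pmf_of_set in
   perm_pmf is applied to a finite nonempty set. *)
lemma tv_dist_summable: "(\<lambda>\<omega>. max 0 (pmf p \<omega> - pmf q \<omega>)) summable_on UNIV"
proof (rule summable_on_comparison_test)
  show "pmf p summable_on UNIV"
    using abs_summable_equivalent[of "pmf p" UNIV] pmf_abs_summable[of p UNIV]
    by (auto dest: summable_on_iff_abs_summable_on_real[THEN iffD2])
qed auto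

lemma finite_short_cycle_perms: "finite (short_cycle_perms n \<alpha>)"
  unfolding short_cycle_perms_def
  by (rule finite_subset[OF _ finite_permutations[of "{1..n}"]]) auto

lemma short_cycle_perms_nonempty:
  assumes "1 \<le> \<alpha> n"
  shows "id \<in> short_cycle_perms n \<alpha>"
proof -
  have "orbit id x = {x}" for x :: nat
    by (auto simp: orbit_altdef)
  then show ?thesis
    using assms by (auto simp: short_cycle_perms_def cycles_of_perm_def permutes_id)
qed

end

theory Submission
  imports Defs
begin

text \<open>
  Let \<open>m = \<lfloor>\<alpha> n\<rfloor>\<close> and \<open>T = \<Sum>j\<le>b. j * Z\<^sub>j\<close>, and let \<open>u\<^sub>a(k)\<close> be the probability that all cycle lengths of
  a uniform permutation of \<open>k\<close> points lie in \<open>{a<..m}\<close>. Counting permutations with prescribed numbers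
  of short cycles shows that \<open>(C\<^sub>1, \<dots>, C\<^sub>b)\<close> has, with respect to the law of \<open>(Z\<^sub>1, \<dots>, Z\<^sub>b)\<close>, the density
  \<open>h(n - T) / u\<^sub>0(n)\<close> with \<open>h = exp (\<Sum>j\<le>b. 1/j) * u\<^sub>b\<close>. The total variation distance is therefore the mean
  of the positive part of \<open>h(n - T) / u\<^sub>0(n) - 1\<close>, and it has to be shown that \<open>h\<close> varies little over
  the range of \<open>T\<close>, whose mean is \<open>b\<close>.

  This works without a saddle point analysis, because \<open>k * u\<^sub>a(k)\<close> is the sum of \<open>u\<^sub>a\<close> over the window
  \<open>{k-m..<k-a}\<close>. The argument rests on three consequences of this recursion.

  First, \<open>u\<^sub>0\<close> is decreasing and log-concave (\<open>cyc_coeff_log_concave\<close>). Hence \<open>u\<^sub>0(k-1) / u\<^sub>0(k)\<close> increases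
  with \<open>k\<close>, and it is at most \<open>(n + m) powr (1 / m)\<close> up to \<open>n\<close>. A shift of the argument by
  \<open>S = \<lfloor>m / ln n\<rfloor>\<close> changes \<open>u\<^sub>0\<close> by a bounded factor only, and a shift by \<open>m + S\<close> by a factor of order
  \<open>n / S\<close> (\<open>cyc_coeff_far_le\<close>).

  Second, \<open>h \<le> 4 * u\<^sub>0\<close> away from \<open>0\<close> (\<open>large_cycle_coeff_le\<close>), since \<open>u\<^sub>0(k)\<close> is the mean of \<open>h(k - T)\<close>.

  Third, the recursion writes \<open>(k + 1) * (h(k+1) - h(k))\<close> as a combination of three values of \<open>h\<close> at
  indices between \<open>k - m\<close> and \<open>k\<close>. By the previous two points, \<open>h / u\<^sub>0(n)\<close> is Lipschitz on
  \<open>{n-S..n}\<close> with a constant of order \<open>1 / S\<close> (\<open>large_cycle_coeff_lipschitz\<close>).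

  Markov's inequality disposes of \<open>T > S\<close>, under the Poisson law as well as under the law of the cycle
  counts. The resulting bound is of order \<open>b / S\<close>, that is \<open>b * ln n / \<alpha> n\<close>
  (\<open>mean_positive_part_le\<close>); it applies when \<open>\<alpha> n / n\<close> and \<open>b * ln n / \<alpha> n\<close> are small, and otherwise the
  distance is at most \<open>1\<close> and the theorem holds with a large constant.
\<close>

section \<open>Coefficients for permutations with restricted cycle lengths\<close>

text \<open>
  The number \<open>cyc_coeff a m k\<close> is the coefficient of \<open>x\<^sup>k\<close> in
  \<open>exp (\<Sum>a<j\<le>m. x\<^sup>j / j)\<close>, which is the probability that all cycle lengths of a uniform
  permutation of \<open>k\<close> points lie between \<open>a + 1\<close> and \<open>m\<close>. The recursion conditions on the length
  \<open>k - i\<close> of the cycle of a given point. Subtraction on the natural numbers cuts the window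
  \<open>{k-m..<k-a}\<close> off at \<open>0\<close>, so that the small values of \<open>k\<close> follow the same formula.
\<close>
fun cyc_coeff :: "nat \<Rightarrow> nat \<Rightarrow> nat \<Rightarrow> real" where
  "cyc_coeff a m k = (if k = 0 then 1 else (\<Sum>i\<in>{k-m..<k-a}. cyc_coeff a m i) / real k)"

declare cyc_coeff.simps [simp del]

lemma cyc_coeff_0 [simp]: "cyc_coeff a m 0 = 1"
  by (simp add: cyc_coeff.simps)

lemma cyc_coeff_window: "real k * cyc_coeff a m k = (\<Sum>i\<in>{k-m..<k-a}. cyc_coeff a m i)"
  by (cases "k = 0") (simp_all add: cyc_coeff.simps[of a m k])

lemma cyc_coeff_unique:
  assumes "f 0 = 1" "\<And>k. 0 < k \<Longrightarrow> real k * f k = (\<Sum>i\<in>{k-m..<k-a}. f i)"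
  shows "f k = cyc_coeff a m k"
proof (induction k rule: less_induct)
  case (less k)
  show ?case
  proof (cases "k = 0")
    case False
    have "real k * f k = (\<Sum>i\<in>{k-m..<k-a}. f i)" using assms(2) False by simp
    also have "\<dots> = (\<Sum>i\<in>{k-m..<k-a}. cyc_coeff a m i)" by (rule sum.cong) (auto intro!: less)
    also have "\<dots> = real k * cyc_coeff a m k" by (rule cyc_coeff_window[symmetric])
    finally show ?thesis using False by simp
  qed (simp add: assms)
qed

lemma cyc_coeff_nonneg: "0 \<le> cyc_coeff a m k"
proof (induction k rule: less_induct)
  case (less k)
  have "0 \<le> (\<Sum>i\<in>{k-m..<k-a}. cyc_coeff a m i)" by (rule sum_nonneg) (auto intro: less)
  then show ?case by (simp add: cyc_coeff.simps[of a m k])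
qed

lemma cyc_coeff_pos: assumes "1 \<le> m" shows "0 < cyc_coeff 0 m k"
proof (induction k rule: less_induct)
  case (less k)
  show ?case
  proof (cases "k = 0")
    case False
    have "0 < (\<Sum>i\<in>{k-m..<k-0}. cyc_coeff 0 m i)"
      by (rule sum_pos) (use False assms in \<open>auto intro: less\<close>)
    then show ?thesis using False by (simp add: cyc_coeff.simps[of 0 m k])
  qed simp
qed

lemma cyc_coeff_eq_0: assumes "0 < k" "k \<le> a" shows "cyc_coeff a m k = 0"
  using assms by (simp add: cyc_coeff.simps[of a m k])

text \<open>
  The windows for \<open>k\<close> and \<open>k + 1\<close> differ in one point at either end.
\<close>
lemma cyc_coeff_step:
  assumes "a \<le> m"
  shows "real (Suc k) * cyc_coeff a m (Suc k) = real k * cyc_coeff a m k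
     + (if a \<le> k then cyc_coeff a m (k - a) else 0) - (if m \<le> k then cyc_coeff a m (k - m) else 0)"
proof (cases "a = m")
  case True
  then show ?thesis using cyc_coeff_window[of "Suc k" m m] cyc_coeff_window[of k m m] by simp
next
  case False
  then have am: "a < m" using assms by simp
  have 1: "(\<Sum>i\<in>{Suc k-m..<Suc k-a}. cyc_coeff a m i)
      = (\<Sum>i\<in>{Suc k-m..<k-a}. cyc_coeff a m i) + (if a \<le> k then cyc_coeff a m (k - a) else 0)"
  proof (cases "a \<le> k")
    case True
    then have "Suc k - a = Suc (k - a)" "Suc k - m \<le> k - a" using am by auto
    then show ?thesis using True by simp
  next
    case False then show ?thesis by simp
  qed
  have 2: "(\<Sum>i\<in>{k-m..<k-a}. cyc_coeff a m i)
      = (\<Sum>i\<in>{Suc k-m..<k-a}. cyc_coeff a m i) + (if m \<le> k then cyc_coeff a m (k - m) else 0)"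
  proof (cases "m \<le> k")
    case True
    then have "Suc k - m = Suc (k - m)" "k - m < k - a" using am by auto
    then show ?thesis using True by (simp add: sum.atLeast_Suc_lessThan)
  next
    case False then show ?thesis by simp
  qed
  show ?thesis using 1 2 cyc_coeff_window[of "Suc k" a m] cyc_coeff_window[of k a m] by simp
qed

lemma cyc_coeff_drop:
  "real (Suc k) * (cyc_coeff 0 m k - cyc_coeff 0 m (Suc k)) = (if m \<le> k then cyc_coeff 0 m (k - m) else 0)"
  using cyc_coeff_step[of 0 m k] by (simp add: algebra_simps)

lemma cyc_coeff_decreasing: "i \<le> j \<Longrightarrow> cyc_coeff 0 m j \<le> cyc_coeff 0 m i"
proof (rule decseqD[of "cyc_coeff 0 m"], rule decseq_SucI)
  fix k
  have "0 \<le> real (Suc k) * (cyc_coeff 0 m k - cyc_coeff 0 m (Suc k))" unfolding cyc_coeff_drop by (simp add: cyc_coeff_nonneg)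
  then show "cyc_coeff 0 m (Suc k) \<le> cyc_coeff 0 m k" by (simp add: zero_le_mult_iff)
qed

text \<open>
  Log-concavity at neighbouring triples makes the ratio \<open>q l / q (l + 1)\<close> increasing; the
  statement compares this ratio at \<open>i\<close> and at \<open>j\<close> with the denominators cleared. Log-concavity
  is assumed for triples that start in \<open>{i..<j}\<close>, which is what an induction on the index can supply.
\<close>
lemma log_concave_cross:
  fixes q :: "nat \<Rightarrow> real"
  assumes pos: "\<And>k. 0 < q k"
    and lc: "\<And>l. i \<le> l \<Longrightarrow> l < j \<Longrightarrow> q l * q (l + 2) \<le> (q (Suc l))\<^sup>2"
    and "i \<le> j"
  shows "q i * q (Suc j) \<le> q (Suc i) * q j"
  using \<open>i \<le> j\<close> lc
proof (induction j rule: dec_induct)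
  case base
  then show ?case by (simp add: mult.commute)
next
  case (step j)
  have IH: "q i * q (Suc j) \<le> q (Suc i) * q j" using step by simp
  have L: "q j * q (j + 2) \<le> (q (Suc j))\<^sup>2" using step by simp
  have "(q i * q (Suc (Suc j))) * (q (Suc j) * q j) = (q i * q (Suc j)) * (q j * q (j + 2))"
    by (simp add: algebra_simps)
  also have "\<dots> \<le> (q (Suc i) * q j) * (q (Suc j))\<^sup>2"
    by (intro mult_mono IH L mult_nonneg_nonneg) (auto intro: less_imp_le pos)
  also have "\<dots> = (q (Suc i) * q (Suc j)) * (q (Suc j) * q j)"
    by (simp add: power2_eq_square algebra_simps)
  finally show ?case
    by (rule mult_right_le_imp_le) (simp add: pos)
qed

text \<open>
  By the one-step formula for \<open>q = cyc_coeff 0 m\<close>, the claim for \<open>k \<ge> m\<close> says that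
  \<open>(l * q l) / q (l - 1 - m)\<close> does not increase from \<open>l = k + 1\<close> to \<open>l = k + 2\<close>. The numerator is a
  sum over a window that starts directly after \<open>l - 1 - m\<close>, so each term of this quotient decreases
  if \<open>q\<close> is log-concave below \<open>k\<close>.
\<close>
lemma cyc_coeff_log_concave:
  assumes m: "1 \<le> m"
  shows "cyc_coeff 0 m k * cyc_coeff 0 m (k + 2) \<le> (cyc_coeff 0 m (Suc k))\<^sup>2"
proof (induction k rule: less_induct)
  case (less k)
  let ?q = "cyc_coeff 0 m"
  have pos: "0 < ?q i" for i by (rule cyc_coeff_pos[OF m])
  show ?case
  proof (cases "k < m")
    case True
    have "?q k = ?q (Suc k)" using cyc_coeff_drop[of k m] True by simp
    moreover have "?q (k + 2) \<le> ?q (Suc k)" by (rule cyc_coeff_decreasing) simp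
    ultimately show ?thesis using pos[of "Suc k"] by (simp add: power2_eq_square)
  next
    case False
    then have mk: "m \<le> k" by simp
    have cross: "?q (k - m) * ?q (Suc j) \<le> ?q (Suc (k - m)) * ?q j" if "k - m \<le> j" "j \<le> k" for j
      by (rule log_concave_cross) (use pos less that in auto)
    have "?q (k - m) * (real (k + 2) * ?q (k + 2)) = ?q (k - m) * (\<Sum>i\<in>{k+2-m..<k+2}. ?q i)"
      using cyc_coeff_window[of "k+2" 0 m] by simp
    also have "(\<Sum>i\<in>{k+2-m..<k+2}. ?q i) = (\<Sum>j\<in>{Suc k-m..<Suc k}. ?q (Suc j))"
      using sum.shift_bounds_Suc_ivl[of ?q "Suc k - m" "Suc k"] mk by (simp add: Suc_diff_le)
    also have "?q (k - m) * \<dots> = (\<Sum>j\<in>{Suc k-m..<Suc k}. ?q (k - m) * ?q (Suc j))"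
      by (rule sum_distrib_left)
    also have "\<dots> \<le> (\<Sum>j\<in>{Suc k-m..<Suc k}. ?q (Suc (k - m)) * ?q j)"
      by (intro sum_mono cross) auto
    also have "\<dots> = ?q (Suc (k - m)) * (\<Sum>j\<in>{Suc k-m..<Suc k}. ?q j)"
      by (rule sum_distrib_left[symmetric])
    also have "\<dots> = ?q (Suc (k - m)) * (real (Suc k) * ?q (Suc k))"
      using cyc_coeff_window[of "Suc k" 0 m] by simp
    finally have main: "?q (k - m) * (real (k + 2) * ?q (k + 2))
        \<le> ?q (Suc (k - m)) * (real (Suc k) * ?q (Suc k))" .
    have d1: "real (Suc k) * (?q k - ?q (Suc k)) = ?q (k - m)" using cyc_coeff_drop[of k m] mk by simp
    have d2: "real (k + 2) * (?q (Suc k) - ?q (k + 2)) = ?q (Suc (k - m))"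
      using cyc_coeff_drop[of "Suc k" m] mk by (simp add: Suc_diff_le)
    have "(real (Suc k) * real (k + 2)) * ((?q k - ?q (Suc k)) * ?q (k + 2))
       \<le> (real (Suc k) * real (k + 2)) * ((?q (Suc k) - ?q (k + 2)) * ?q (Suc k))"
      using main unfolding d1[symmetric] d2[symmetric] by (simp add: algebra_simps)
    then have "(?q k - ?q (Suc k)) * ?q (k + 2) \<le> (?q (Suc k) - ?q (k + 2)) * ?q (Suc k)"
      by (rule mult_left_le_imp_le) simp
    then show ?thesis by (simp add: algebra_simps power2_eq_square)
  qed
qed

text \<open>
  The ratio \<open>r = q n / q (n + 1)\<close> bounds all earlier ratios by log-concavity. It also
  bounds the \<open>m\<close> following ratios from below, so \<open>r ^ m \<le> q n / q (n + m)\<close>; and \<open>q n\<close> is one of the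
  terms of the window that sums to \<open>(n + m) * q (n + m)\<close>. Hence \<open>r \<le> (n + m) powr (1 / m)\<close>.
\<close>
lemma cyc_coeff_ratio_le:
  assumes m: "1 \<le> m" and ij: "i + j \<le> Suc n"
  shows "cyc_coeff 0 m i \<le> real (n + m) powr (real j / real m) * cyc_coeff 0 m (i + j)"
proof -
  let ?q = "cyc_coeff 0 m"
  have pos: "0 < ?q i" for i by (rule cyc_coeff_pos[OF m])
  define r where "r = ?q n / ?q (Suc n)"
  have r0: "0 < r" by (simp add: r_def pos)
  have cross: "?q i * ?q (Suc j) \<le> ?q (Suc i) * ?q j" if "i \<le> j" for i j
    by (rule log_concave_cross) (use that cyc_coeff_log_concave[OF m] pos in auto)
  have up: "r ^ l * ?q (n + l) \<le> ?q n" for l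
  proof (induction l)
    case (Suc l)
    have "r * ?q (Suc (n + l)) \<le> ?q (n + l)"
      using cross[of n "n + l"] pos[of "Suc n"] by (simp add: r_def field_simps)
    then have "r ^ l * (r * ?q (Suc (n + l))) \<le> r ^ l * ?q (n + l)"
      using r0 by (intro mult_left_mono) auto
    then show ?case using Suc by (simp add: algebra_simps)
  qed simp
  have "?q n \<le> (\<Sum>i\<in>{n+m-m..<n+m-0}. ?q i)"
    by (rule member_le_sum) (use m in \<open>auto intro: cyc_coeff_nonneg\<close>)
  also have "\<dots> = real (n + m) * ?q (n + m)" by (rule cyc_coeff_window[symmetric])
  finally have "r ^ m * ?q (n + m) \<le> real (n + m) * ?q (n + m)"
    using up[of m] by linarith
  then have rm: "r ^ m \<le> real (n + m)"
    by (rule mult_right_le_imp_le) (rule pos)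
  have rle: "r \<le> real (n + m) powr (1 / real m)"
  proof -
    have "r = (r ^ m) powr (1 / real m)"
      using r0 m by (simp add: powr_realpow[symmetric] powr_powr)
    also have "\<dots> \<le> real (n + m) powr (1 / real m)"
      using rm r0 by (intro powr_mono2) auto
    finally show ?thesis .
  qed
  have down: "l \<le> j \<Longrightarrow> ?q i \<le> r ^ l * ?q (i + l)" for l
  proof (induction l)
    case (Suc l)
    have "?q (i + l) \<le> r * ?q (Suc (i + l))"
      using cross[of "i + l" n] pos[of "Suc n"] ij Suc.prems by (simp add: r_def field_simps)
    then have "r ^ l * ?q (i + l) \<le> r ^ l * (r * ?q (Suc (i + l)))"
      using r0 by (intro mult_left_mono) auto
    then show ?case using Suc by (simp add: algebra_simps)
  qed simp
  have "?q i \<le> r ^ j * ?q (i + j)" by (rule down) simp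
  also have "\<dots> \<le> (real (n + m) powr (1 / real m)) ^ j * ?q (i + j)"
    using r0 rle by (intro mult_right_mono power_mono cyc_coeff_nonneg) auto
  also have "(real (n + m) powr (1 / real m)) ^ j = real (n + m) powr (real j / real m)"
    using m by (subst powr_realpow[symmetric]) (auto simp: powr_powr)
  finally show ?thesis .
qed

text \<open>
  Near the far end of the window for \<open>n\<close> there are \<open>S\<close> indices at which \<open>q\<close> is at least
  \<open>q (n - m + S)\<close>, while the whole window sums to \<open>n * q n\<close>. The ratio bound moves the index from
  \<open>n - m + S\<close> back to \<open>n - m - S\<close>. If \<open>S\<close> is about \<open>m / ln n\<close>, the power is bounded and the total
  loss is of order \<open>n * ln n / m\<close>.
\<close>
lemma cyc_coeff_far_le:
  assumes S: "1 \<le> S" "S \<le> m" "m + S \<le> n"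
  shows "cyc_coeff 0 m (n - m - S) \<le> real (n + m) powr (real (2 * S) / real m) * (real n / real S) * cyc_coeff 0 m n"
proof -
  let ?q = "cyc_coeff 0 m"
  have "real S * ?q (n - m + S) = (\<Sum>i\<in>{n-m..<n-m+S}. ?q (n - m + S))" by simp
  also have "\<dots> \<le> (\<Sum>i\<in>{n-m..<n-m+S}. ?q i)"
    by (intro sum_mono cyc_coeff_decreasing) auto
  also have "\<dots> \<le> (\<Sum>i\<in>{n-m..<n-0}. ?q i)"
    by (rule sum_mono2) (use S in \<open>auto intro: cyc_coeff_nonneg\<close>)
  also have "\<dots> = real n * ?q n" by (rule cyc_coeff_window[symmetric])
  finally have 1: "?q (n - m + S) \<le> real n / real S * ?q n" using S by (simp add: field_simps)
  have "?q (n - m - S) \<le> real (n + m) powr (real (2 * S) / real m) * ?q (n - m - S + 2 * S)"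
    by (rule cyc_coeff_ratio_le) (use S in auto)
  also have "n - m - S + 2 * S = n - m + S" using S by simp
  also have "real (n + m) powr (real (2 * S) / real m) * ?q (n - m + S)
    \<le> real (n + m) powr (real (2 * S) / real m) * (real n / real S * ?q n)"
    by (intro mult_left_mono 1) simp
  finally show ?thesis by (simp add: mult.assoc)
qed

section \<open>Splitting off the short cycles\<close>

text \<open>
  With \<open>P = window_fps a m\<close>, the window recursion reads \<open>x * F' = P * F\<close> for the generating
  function \<open>F\<close> of \<open>cyc_coeff a m\<close>. Since \<open>P\<close> is additive in the set of admissible lengths, generating
  functions multiply when disjoint ranges of lengths are joined.
\<close>
definition window_fps :: "nat \<Rightarrow> nat \<Rightarrow> real fps" where
  "window_fps a m = Abs_fps (\<lambda>j. if a < j \<and> j \<le> m then 1 else 0)"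

lemma window_fps_mult_nth: "fps_nth (window_fps a m * F) k = (\<Sum>i\<in>{k-m..<k-a}. fps_nth F i)"
proof -
  have "fps_nth (window_fps a m * F) k = (\<Sum>i=0..k. fps_nth F i * fps_nth (window_fps a m) (k - i))"
    by (subst mult.commute) (simp add: fps_mult_nth)
  also have "\<dots> = (\<Sum>i\<in>{k-m..<k-a}. fps_nth F i)"
    by (rule sum.mono_neutral_cong_right) (auto simp: window_fps_def)
  finally show ?thesis .
qed

lemma fps_X_deriv_nth: "fps_nth (fps_X * fps_deriv F) k = of_nat k * fps_nth (F :: 'a :: comm_semiring_1 fps) k"
  by (cases k) simp_all

lemma cyc_coeff_deriv: "fps_X * fps_deriv (Abs_fps (cyc_coeff a m)) = window_fps a m * Abs_fps (cyc_coeff a m)"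
proof (rule fps_ext)
  fix k show "fps_nth (fps_X * fps_deriv (Abs_fps (cyc_coeff a m))) k = fps_nth (window_fps a m * Abs_fps (cyc_coeff a m)) k"
    using cyc_coeff_window[of k a m] by (simp add: fps_X_deriv_nth window_fps_mult_nth)
qed

lemma window_fps_add: "a \<le> b \<Longrightarrow> b \<le> m \<Longrightarrow> window_fps a b + window_fps b m = window_fps a m"
  by (rule fps_ext) (auto simp: window_fps_def)

lemma cyc_coeff_mult:
  assumes "a \<le> b" "b \<le> m"
  shows "Abs_fps (cyc_coeff a b) * Abs_fps (cyc_coeff b m) = Abs_fps (cyc_coeff a m)"
proof (rule fps_ext)
  fix k
  let ?F = "Abs_fps (cyc_coeff a b) * Abs_fps (cyc_coeff b m)"
  have d: "fps_X * fps_deriv ?F = window_fps a m * ?F"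
  proof -
    have "fps_X * fps_deriv ?F = Abs_fps (cyc_coeff a b) * (fps_X * fps_deriv (Abs_fps (cyc_coeff b m)))
       + (fps_X * fps_deriv (Abs_fps (cyc_coeff a b))) * Abs_fps (cyc_coeff b m)"
      by (simp add: algebra_simps)
    also have "\<dots> = window_fps a m * ?F"
      unfolding cyc_coeff_deriv window_fps_add[OF assms, symmetric] by (simp add: algebra_simps)
    finally show ?thesis .
  qed
  have "fps_nth ?F k = cyc_coeff a m k"
  proof (rule cyc_coeff_unique)
    fix k :: nat assume "0 < k"
    then show "real k * fps_nth ?F k = (\<Sum>i\<in>{k-m..<k-a}. fps_nth ?F i)"
      using arg_cong[OF d, of "\<lambda>f. fps_nth f k"] unfolding window_fps_mult_nth fps_X_deriv_nth by simp
  qed simp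
  then show "fps_nth ?F k = fps_nth (Abs_fps (cyc_coeff a m)) k" by simp
qed

lemma cyc_coeff_convolution:
  assumes "a \<le> b" "b \<le> m"
  shows "cyc_coeff a m n = (\<Sum>s\<le>n. cyc_coeff a b s * cyc_coeff b m (n - s))"
  using arg_cong[OF cyc_coeff_mult[OF assms], of "\<lambda>f. fps_nth f n"]
  by (simp add: fps_mult_nth atMost_atLeast0)

text \<open>
  The weight \<open>s\<close> turns the first factor \<open>F\<close> into \<open>x * F'\<close>. Probabilistically this is the mean
  number of points in cycles of length at most \<open>b\<close> (for \<open>a = 0\<close>), up to normalisation by \<open>cyc_coeff a m n\<close>.
\<close>
lemma cyc_coeff_convolution_weighted:
  assumes "a \<le> b" "b \<le> m"
  shows "(\<Sum>s\<le>n. real s * cyc_coeff a b s * cyc_coeff b m (n - s)) = (\<Sum>i\<in>{n-b..<n-a}. cyc_coeff a m i)"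
proof -
  let ?d = "fps_X * fps_deriv (Abs_fps (cyc_coeff a b))"
  have nth: "fps_nth ?d s = real s * cyc_coeff a b s" for s by (simp add: fps_X_deriv_nth)
  have "?d * Abs_fps (cyc_coeff b m) = window_fps a b * Abs_fps (cyc_coeff a m)"
    unfolding cyc_coeff_deriv cyc_coeff_mult[OF assms, symmetric] by (simp add: mult.assoc)
  from arg_cong[OF this, of "\<lambda>f. fps_nth f n"] show ?thesis
    unfolding fps_mult_nth[of ?d] nth window_fps_mult_nth by (simp add: atMost_atLeast0)
qed


text \<open>
  In the next lemmas \<open>Z\<close> is the total mass of \<open>cyc_coeff 0 b\<close>, so \<open>s \<mapsto> cyc_coeff 0 b s / Z\<close> is a
  probability distribution. It is the law of \<open>T = \<Sum>j\<le>b. j * Z\<^sub>j\<close> with independent Poisson variables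
  \<open>Z\<^sub>j\<close> of mean \<open>1 / j\<close>, whose mean is \<open>b\<close>.
\<close>
lemma cyc_coeff_mean_le:
  assumes "(cyc_coeff 0 b) sums Z"
  shows "(\<Sum>s\<le>N. real s * cyc_coeff 0 b s) \<le> real b * Z"
proof -
  have "(\<Sum>s\<le>N. real s * cyc_coeff 0 b s) = (\<Sum>s\<le>N. \<Sum>i | i \<le> N \<and> s - b \<le> i \<and> i < s. cyc_coeff 0 b i)"
    unfolding cyc_coeff_window by (intro sum.cong refl) auto
  also have "\<dots> = (\<Sum>i\<le>N. \<Sum>s | s \<le> N \<and> s - b \<le> i \<and> i < s. cyc_coeff 0 b i)"
    using sum.swap_restrict[of "{..N}" "{..N}" "\<lambda>s i. cyc_coeff 0 b i" "\<lambda>s i. s - b \<le> i \<and> i < s"] by simp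
  also have "\<dots> \<le> (\<Sum>i\<le>N. real b * cyc_coeff 0 b i)"
  proof (rule sum_mono)
    fix i
    have "card {s. s \<le> N \<and> s - b \<le> i \<and> i < s} \<le> card {i<..i+b}"
      by (rule card_mono) auto
    then show "(\<Sum>s | s \<le> N \<and> s - b \<le> i \<and> i < s. cyc_coeff 0 b i) \<le> real b * cyc_coeff 0 b i"
      by (auto intro!: mult_right_mono cyc_coeff_nonneg)
  qed
  also have "\<dots> = real b * (\<Sum>i\<le>N. cyc_coeff 0 b i)" by (rule sum_distrib_left[symmetric])
  also have "\<dots> \<le> real b * Z"
    using assms by (intro mult_left_mono) (auto simp: sums_iff cyc_coeff_nonneg intro!: sum_le_suminf)
  finally show ?thesis .
qed

lemma sum_atMost_split:
  fixes f :: "nat \<Rightarrow> 'a :: comm_monoid_add"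
  assumes "S \<le> n"
  shows "sum f {..n} = sum f {..S} + sum f {S<..n}"
proof -
  have "{..n} = {..S} \<union> {S<..n}" using assms by auto
  moreover have "sum f ({..S} \<union> {S<..n}) = sum f {..S} + sum f {S<..n}"
    by (rule sum.union_disjoint) auto
  ultimately show ?thesis by simp
qed

text \<open>
  Markov's inequality for \<open>T\<close>.
\<close>
lemma cyc_coeff_tail_le:
  assumes "(cyc_coeff 0 b) sums Z"
  shows "real S * (Z - (\<Sum>s\<le>S. cyc_coeff 0 b s)) \<le> real b * Z"
proof (rule LIMSEQ_le_const2)
  show "(\<lambda>N. real S * ((\<Sum>s\<le>N. cyc_coeff 0 b s) - (\<Sum>s\<le>S. cyc_coeff 0 b s)))
     \<longlonglongrightarrow> real S * (Z - (\<Sum>s\<le>S. cyc_coeff 0 b s))"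
    using assms unfolding sums_def_le by (intro tendsto_intros)
  show "\<exists>N0. \<forall>N\<ge>N0. real S * ((\<Sum>s\<le>N. cyc_coeff 0 b s) - (\<Sum>s\<le>S. cyc_coeff 0 b s)) \<le> real b * Z"
  proof (intro exI allI impI)
    fix N assume "S \<le> N"
    then have "(\<Sum>s\<le>N. cyc_coeff 0 b s) = (\<Sum>s\<le>S. cyc_coeff 0 b s) + (\<Sum>s\<in>{S<..N}. cyc_coeff 0 b s)"
      by (rule sum_atMost_split)
    then have "real S * ((\<Sum>s\<le>N. cyc_coeff 0 b s) - (\<Sum>s\<le>S. cyc_coeff 0 b s)) = (\<Sum>s\<in>{S<..N}. real S * cyc_coeff 0 b s)"
      by (simp add: sum_distrib_left)
    also have "\<dots> \<le> (\<Sum>s\<in>{S<..N}. real s * cyc_coeff 0 b s)"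
      by (intro sum_mono mult_right_mono cyc_coeff_nonneg) auto
    also have "\<dots> \<le> (\<Sum>s\<le>N. real s * cyc_coeff 0 b s)"
      by (rule sum_mono2) (auto simp: cyc_coeff_nonneg)
    also have "\<dots> \<le> real b * Z" by (rule cyc_coeff_mean_le[OF assms])
    finally show "real S * ((\<Sum>s\<le>N. cyc_coeff 0 b s) - (\<Sum>s\<le>S. cyc_coeff 0 b s)) \<le> real b * Z" .
  qed
qed

text \<open>
  Write \<open>q = cyc_coeff 0 m\<close> and \<open>h = Z * cyc_coeff b m\<close>. The convolution formula says that
  \<open>q l\<close> is the mean of \<open>h (l - T)\<close>, which bounds \<open>h\<close> at a single point only badly. It is effective for
  sums over windows: with probability at least \<open>1 / 2\<close> we have \<open>T \<le> 2 * b\<close>, and then the shifted window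
  \<open>{k-m..<k+b} - T\<close> covers \<open>{k-m..<k-b}\<close>. The sum of \<open>h\<close> over the latter is \<open>k * h k\<close>, and the sum of
  \<open>q\<close> over the former is at most \<open>(k + b) * q k\<close>.
\<close>
lemma large_cycle_coeff_le:
  assumes Z: "(cyc_coeff 0 b) sums Z" and b: "1 \<le> b" "b \<le> m" and k: "1 \<le> k"
  shows "Z * cyc_coeff b m k \<le> 4 * cyc_coeff 0 m k"
proof (cases "k \<le> b")
  case True
  then show ?thesis using k by (simp add: cyc_coeff_eq_0 cyc_coeff_nonneg)
next
  case False
  let ?q = "cyc_coeff 0 m" and ?h = "cyc_coeff b m"
  let ?w = "\<Sum>i\<in>{k-m..<k-b}. ?h i"
  have w0: "0 \<le> ?w" by (intro sum_nonneg cyc_coeff_nonneg)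
  have half: "Z \<le> 2 * (\<Sum>s\<le>2*b. cyc_coeff 0 b s)"
    using cyc_coeff_tail_le[OF Z, of "2 * b"] b by (simp add: algebra_simps)
  have "(\<Sum>s\<le>2*b. cyc_coeff 0 b s) * ?w \<le> (\<Sum>s\<le>2*b. cyc_coeff 0 b s * (\<Sum>l\<in>{l. k - m \<le> l \<and> l < k + b \<and> s \<le> l}. ?h (l - s)))"
    unfolding sum_distrib_right
  proof (intro sum_mono mult_left_mono cyc_coeff_nonneg)
    fix s assume s: "s \<in> {..2*b}"
    have "?w = (\<Sum>l\<in>(\<lambda>i. i + s) ` {k-m..<k-b}. ?h (l - s))"
      by (subst sum.reindex) (auto simp: inj_on_def)
    also have "\<dots> \<le> (\<Sum>l\<in>{l. k - m \<le> l \<and> l < k + b \<and> s \<le> l}. ?h (l - s))"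
      by (rule sum_mono2) (use s False in \<open>auto intro: cyc_coeff_nonneg\<close>)
    finally show "?w \<le> (\<Sum>l\<in>{l. k - m \<le> l \<and> l < k + b \<and> s \<le> l}. ?h (l - s))" .
  qed
  also have "\<dots> = (\<Sum>s\<le>2*b. \<Sum>l\<in>{l\<in>{k-m..<k+b}. s \<le> l}. cyc_coeff 0 b s * ?h (l - s))"
    unfolding sum_distrib_left by (intro sum.cong refl) auto
  also have "\<dots> = (\<Sum>l\<in>{k-m..<k+b}. \<Sum>s\<in>{s\<in>{..2*b}. s \<le> l}. cyc_coeff 0 b s * ?h (l - s))"
    by (rule sum.swap_restrict) auto
  also have "\<dots> \<le> (\<Sum>l\<in>{k-m..<k+b}. ?q l)"
  proof (rule sum_mono)
    fix l
    have "(\<Sum>s\<in>{s\<in>{..2*b}. s \<le> l}. cyc_coeff 0 b s * ?h (l - s)) \<le> (\<Sum>s\<le>l. cyc_coeff 0 b s * ?h (l - s))"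
      by (rule sum_mono2) (auto intro: cyc_coeff_nonneg mult_nonneg_nonneg)
    then show "(\<Sum>s\<in>{s\<in>{..2*b}. s \<le> l}. cyc_coeff 0 b s * ?h (l - s)) \<le> ?q l"
      using cyc_coeff_convolution[of 0 b m l] b by simp
  qed
  also have "\<dots> = (\<Sum>l\<in>{k-m..<k}. ?q l) + (\<Sum>l\<in>{k..<k+b}. ?q l)"
    by (rule sum.atLeastLessThan_concat[symmetric]) auto
  also have "(\<Sum>l\<in>{k-m..<k}. ?q l) = real k * ?q k" using cyc_coeff_window[of k 0 m] by simp
  also have "(\<Sum>l\<in>{k..<k+b}. ?q l) \<le> (\<Sum>l\<in>{k..<k+b}. ?q k)"
    by (intro sum_mono cyc_coeff_decreasing) auto
  also have "\<dots> = real b * ?q k" by simp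
  also have "\<dots> \<le> real k * ?q k"
    using False by (intro mult_right_mono cyc_coeff_nonneg) simp
  finally have "(\<Sum>s\<le>2*b. cyc_coeff 0 b s) * ?w \<le> 2 * (real k * ?q k)" by simp
  moreover have "Z * ?w \<le> 2 * (\<Sum>s\<le>2*b. cyc_coeff 0 b s) * ?w" by (rule mult_right_mono[OF half w0])
  ultimately have "Z * ?w \<le> 4 * (real k * ?q k)" by simp
  then have "real k * (Z * ?h k) \<le> real k * (4 * ?q k)"
    using cyc_coeff_window[of k b m] by (simp add: algebra_simps)
  then show ?thesis using k by simp
qed

lemma large_cycle_coeff_step:
  assumes Z: "(cyc_coeff 0 b) sums Z" and b: "1 \<le> b" "b \<le> m" and k: "m < k"
  shows "\<bar>Z * cyc_coeff b m (Suc k) - Z * cyc_coeff b m k\<bar> \<le> 12 * cyc_coeff 0 m (k - m) / real k"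
proof -
  have Z0: "0 \<le> Z" using Z by (auto simp: sums_iff cyc_coeff_nonneg intro!: suminf_nonneg)
  define A where "A = Z * cyc_coeff b m k"
  define B where "B = Z * cyc_coeff b m (k - b)"
  define C where "C = Z * cyc_coeff b m (k - m)"
  define Q where "Q = 4 * cyc_coeff 0 m (k - m)"
  define D where "D = Z * cyc_coeff b m (Suc k) - Z * cyc_coeff b m k"
  have nn: "0 \<le> A" "0 \<le> B" "0 \<le> C" using Z0 by (simp_all add: A_def B_def C_def cyc_coeff_nonneg)
  have le: "Z * cyc_coeff b m i \<le> Q" if "k - m \<le> i" for i
  proof -
    have "1 \<le> i" using that k by simp
    then show ?thesis using large_cycle_coeff_le[OF Z b, of i] cyc_coeff_decreasing[OF that, of m] by (simp add: Q_def)
  qed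
  have up: "A \<le> Q" "B \<le> Q" "C \<le> Q" unfolding A_def B_def C_def using b by (auto intro!: le)
  have "real (Suc k) * cyc_coeff b m (Suc k) = real k * cyc_coeff b m k + cyc_coeff b m (k - b) - cyc_coeff b m (k - m)"
    using cyc_coeff_step[OF b(2), of k] b k by simp
  from arg_cong[OF this, of "\<lambda>x. Z * x"] have eq: "real (Suc k) * D = B - C - A"
    by (simp add: A_def B_def C_def D_def algebra_simps)
  have "real (Suc k) * \<bar>D\<bar> = \<bar>B - C - A\<bar>" unfolding eq[symmetric] by (simp add: abs_mult)
  also have "\<dots> \<le> 3 * Q" using nn up by linarith
  finally have "real (Suc k) * \<bar>D\<bar> \<le> 3 * Q" .
  moreover have "real k * \<bar>D\<bar> \<le> real (Suc k) * \<bar>D\<bar>" by (intro mult_right_mono) auto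
  ultimately have "real k * \<bar>D\<bar> \<le> 3 * Q" by linarith
  then show ?thesis using k unfolding D_def[symmetric] Q_def by (simp add: field_simps)
qed

text \<open>
  Each of the \<open>s\<close> steps between \<open>n - s\<close> and \<open>n\<close> is bounded through values of \<open>cyc_coeff 0 m\<close> at indices
  that are at least \<open>n - m - S\<close>.
\<close>
lemma large_cycle_coeff_lipschitz:
  assumes Z: "(cyc_coeff 0 b) sums Z" and b: "1 \<le> b" "b \<le> m"
    and S: "s \<le> S" "m + S < n" "2 * S \<le> n"
  shows "\<bar>Z * cyc_coeff b m (n - s) - Z * cyc_coeff b m n\<bar> \<le> real s * (24 * cyc_coeff 0 m (n - m - S) / real n)"
  using S(1)
proof (induction s)
  case (Suc s)
  define k where "k = n - Suc s"
  have k: "Suc k = n - s" "m < k" "n - m - S \<le> k - m" "real n \<le> 2 * real k"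
    using S Suc.prems by (auto simp: k_def)
  have "\<bar>Z * cyc_coeff b m (Suc k) - Z * cyc_coeff b m k\<bar> \<le> 12 * cyc_coeff 0 m (k - m) / real k"
    by (rule large_cycle_coeff_step[OF Z b k(2)])
  also have "\<dots> \<le> 12 * cyc_coeff 0 m (n - m - S) / (real n / 2)"
    using k S by (intro frac_le mult_left_mono cyc_coeff_decreasing) (auto intro: cyc_coeff_nonneg)
  finally have "\<bar>Z * cyc_coeff b m (n - s) - Z * cyc_coeff b m (n - Suc s)\<bar> \<le> 24 * cyc_coeff 0 m (n - m - S) / real n"
    unfolding k(1) by (simp add: k_def)
  moreover have "\<bar>Z * cyc_coeff b m (n - s) - Z * cyc_coeff b m n\<bar> \<le> real s * (24 * cyc_coeff 0 m (n - m - S) / real n)"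
    using Suc by simp
  ultimately have "\<bar>Z * cyc_coeff b m (n - Suc s) - Z * cyc_coeff b m n\<bar>
      \<le> real s * (24 * cyc_coeff 0 m (n - m - S) / real n) + 24 * cyc_coeff 0 m (n - m - S) / real n"
    by linarith
  then show ?case by (simp only: of_nat_Suc distrib_right mult_1_left add.commute)
qed simp

text \<open>
  This is the one-dimensional form of the total variation bound. Let \<open>h\<close> be scaled so that
  \<open>h s = Z * cyc_coeff b m (n - s) / cyc_coeff 0 m n\<close>; its mean under the law \<open>t\<close> of \<open>T\<close> is \<open>1\<close>, and
  the mean of \<open>(h T - 1)\<^sub>+\<close> is to be bounded. On \<open>{..S}\<close> the function \<open>h\<close> is Lipschitz with constant of
  order \<open>1 / S\<close> and \<open>T\<close> has mean \<open>b\<close>, so \<open>h T\<close> is close to \<open>h 0\<close>; since \<open>T \<le> S\<close> is likely and the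
  mean of \<open>h T\<close> is \<open>1\<close>, the value \<open>h 0\<close> exceeds \<open>1\<close> only by a multiple of \<open>b / S\<close>. Beyond \<open>S\<close>, Markov's
  inequality is applied under the law with density \<open>h\<close>, where the mean of \<open>T\<close> is of order \<open>b\<close>
  by the weighted convolution.
\<close>
lemma mean_positive_part_le:
  fixes K :: real
  assumes Z: "(cyc_coeff 0 b) sums Z" and b: "1 \<le> b" "b \<le> S" and S: "S \<le> m" "m + S < n"
    and K: "K = real (n + m) powr (real (2 * S) / real m)"
  shows "(\<Sum>s\<le>n. cyc_coeff 0 b s / Z * max 0 (Z * cyc_coeff b m (n - s) / cyc_coeff 0 m n - 1)) \<le> (49 * K + 4) * (real b / real S)"
proof -
  define Q where "Q = cyc_coeff 0 m n"
  define t where "t s = cyc_coeff 0 b s / Z" for s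
  define h where "h s = Z * cyc_coeff b m (n - s) / Q" for s
  define \<beta> where "\<beta> = real b / real S"
  define \<delta> where "\<delta> = 24 * K / real S"
  have m: "1 \<le> m" "b \<le> m" using b S by auto
  have S0: "0 < real S" and n0: "0 < real n" using b S by auto
  have Q: "0 < Q" unfolding Q_def by (rule cyc_coeff_pos[OF m(1)])
  have "0 < (\<Sum>s<1. cyc_coeff 0 b s)" by simp
  also have "\<dots> \<le> Z" using Z sum_le_suminf[of "cyc_coeff 0 b" "{..<1}"] by (simp add: sums_iff cyc_coeff_nonneg)
  finally have Z0: "0 < Z" .
  have K0: "0 \<le> K" by (simp add: K)
  have t0: "0 \<le> t s" for s using Z0 by (simp add: t_def cyc_coeff_nonneg)
  have h0: "0 \<le> h s" for s using Z0 Q by (simp add: h_def cyc_coeff_nonneg)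
  have \<delta>0: "0 \<le> \<delta>" using K0 by (simp add: \<delta>_def)
  have far: "cyc_coeff 0 m (n - m - S) \<le> K * (real n / real S) * Q"
    unfolding K Q_def by (rule cyc_coeff_far_le) (use b S in auto)
  have lip: "\<bar>h s - h 0\<bar> \<le> \<delta> * real s" if "s \<le> S" for s
  proof -
    have "Q * \<bar>h s - h 0\<bar> = \<bar>Z * cyc_coeff b m (n - s) - Z * cyc_coeff b m n\<bar>"
      using Q by (simp add: h_def diff_divide_distrib[symmetric] abs_divide)
    also have "\<dots> \<le> real s * (24 * cyc_coeff 0 m (n - m - S) / real n)"
      by (rule large_cycle_coeff_lipschitz[OF Z b(1) m(2) that]) (use S in auto)
    also have "\<dots> \<le> real s * (24 * (K * (real n / real S) * Q) / real n)"
      by (intro mult_left_mono divide_right_mono far) auto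
    also have "\<dots> = Q * (\<delta> * real s)" using n0 S0 by (simp add: \<delta>_def field_simps)
    finally show ?thesis using Q by simp
  qed
  have mass: "(\<Sum>s\<le>S. t s) \<le> 1"
  proof -
    have "(\<Sum>s\<le>S. cyc_coeff 0 b s) \<le> Z"
      using Z sum_le_suminf[of "cyc_coeff 0 b" "{..S}"] by (simp add: sums_iff cyc_coeff_nonneg)
    then show ?thesis using Z0 by (simp add: t_def sum_divide_distrib[symmetric])
  qed
  have most: "1 - \<beta> \<le> (\<Sum>s\<le>S. t s)"
    using cyc_coeff_tail_le[OF Z, of S] Z0 S0
    by (simp add: t_def \<beta>_def sum_divide_distrib[symmetric] field_simps)
  have mean: "(\<Sum>s\<le>S. t s * real s) \<le> real b"
    using cyc_coeff_mean_le[OF Z, of S] Z0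
    by (simp add: t_def sum_divide_distrib[symmetric] field_simps)
  have \<delta>b: "\<delta> * real b = 24 * K * \<beta>" by (simp add: \<delta>_def \<beta>_def)
  have total: "(\<Sum>s\<le>n. t s * h s) = 1"
    using cyc_coeff_convolution[of 0 b m n] m Q Z0 by (simp add: t_def h_def Q_def sum_divide_distrib[symmetric])
  have h4: "h 0 \<le> 4"
    using large_cycle_coeff_le[OF Z b(1) m(2), of n] Q n0 by (simp add: h_def Q_def field_simps)
  \<comment> \<open>The term \<open>4 * \<beta>\<close> bounds \<open>h 0\<close> times the mass beyond \<open>S\<close>.\<close>
  have "h 0 - 1 \<le> 4 * \<beta> + 24 * K * \<beta>"
  proof -
    have "(1 - \<beta>) * h 0 \<le> (\<Sum>s\<le>S. t s) * h 0" by (rule mult_right_mono[OF most h0])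
    also have "\<dots> = (\<Sum>s\<le>S. t s * h 0)" by (rule sum_distrib_right)
    also have "\<dots> \<le> (\<Sum>s\<le>S. t s * (h s + \<delta> * real s))"
    proof (intro sum_mono mult_left_mono t0)
      fix s assume "s \<in> {..S}" then show "h 0 \<le> h s + \<delta> * real s" using lip[of s] by auto
    qed
    also have "\<dots> = (\<Sum>s\<le>S. t s * h s) + \<delta> * (\<Sum>s\<le>S. t s * real s)"
      by (simp add: algebra_simps sum.distrib sum_distrib_left)
    also have "(\<Sum>s\<le>S. t s * h s) \<le> (\<Sum>s\<le>n. t s * h s)"
      by (rule sum_mono2) (use S t0 h0 in auto)
    also have "\<delta> * (\<Sum>s\<le>S. t s * real s) \<le> \<delta> * real b" by (rule mult_left_mono[OF mean \<delta>0])
    finally have "(1 - \<beta>) * h 0 \<le> 1 + 24 * K * \<beta>" unfolding total \<delta>b by simp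
    moreover have "\<beta> * h 0 \<le> \<beta> * 4" by (intro mult_left_mono h4) (simp add: \<beta>_def)
    ultimately show ?thesis by (simp add: algebra_simps)
  qed
  then have near0: "max 0 (h s - 1) \<le> \<delta> * real s + (4 * \<beta> + 24 * K * \<beta>)" if "s \<le> S" for s
    using lip[OF that] \<delta>0 K0 by (auto simp: \<beta>_def)
  have near: "(\<Sum>s\<le>S. t s * max 0 (h s - 1)) \<le> (4 + 48 * K) * \<beta>"
  proof -
    have "(\<Sum>s\<le>S. t s * max 0 (h s - 1)) \<le> (\<Sum>s\<le>S. t s * (\<delta> * real s + (4 * \<beta> + 24 * K * \<beta>)))"
      by (intro sum_mono mult_left_mono t0 near0) simp
    also have "\<dots> = \<delta> * (\<Sum>s\<le>S. t s * real s) + (\<Sum>s\<le>S. t s) * (4 * \<beta> + 24 * K * \<beta>)"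
      by (simp add: distrib_left sum.distrib sum_distrib_left sum_distrib_right mult_ac)
    also have "\<dots> \<le> \<delta> * real b + 1 * (4 * \<beta> + 24 * K * \<beta>)"
      by (intro add_mono mult_left_mono mult_right_mono mean mass \<delta>0) (simp add: \<beta>_def K0)
    also have "\<dots> = (4 + 48 * K) * \<beta>" unfolding \<delta>b by (simp add: algebra_simps)
    finally show ?thesis .
  qed
  have far_tail: "(\<Sum>s\<in>{S<..n}. t s * max 0 (h s - 1)) \<le> K * \<beta>"
  proof -
    have "real S * (\<Sum>s\<in>{S<..n}. t s * max 0 (h s - 1)) \<le> (\<Sum>s\<in>{S<..n}. real s * (t s * h s))"
      unfolding sum_distrib_left
      by (intro sum_mono mult_mono mult_left_mono t0 mult_nonneg_nonneg) (use h0 in auto)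
    also have "\<dots> \<le> (\<Sum>s\<le>n. real s * (t s * h s))"
      by (rule sum_mono2) (use t0 h0 in auto)
    also have "\<dots> = (\<Sum>s\<le>n. real s * cyc_coeff 0 b s * cyc_coeff b m (n - s)) / Q"
      using Z0 by (simp add: t_def h_def sum_divide_distrib mult_ac)
    also have "\<dots> = (\<Sum>i\<in>{n-b..<n}. cyc_coeff 0 m i) / Q"
      using cyc_coeff_convolution_weighted[of 0 b m n] m by simp
    also have "\<dots> \<le> (\<Sum>i\<in>{n-b..<n}. K * Q) / Q"
    proof (intro divide_right_mono sum_mono)
      fix i assume i: "i \<in> {n-b..<n}"
      have "cyc_coeff 0 m i \<le> cyc_coeff 0 m (n - S)" using i b by (intro cyc_coeff_decreasing) auto
      also have "\<dots> \<le> real (n + m) powr (real S / real m) * cyc_coeff 0 m (n - S + S)"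
        by (rule cyc_coeff_ratio_le) (use m S in auto)
      also have "n - S + S = n" using S by simp
      also have "real (n + m) powr (real S / real m) * cyc_coeff 0 m n \<le> K * cyc_coeff 0 m n"
        unfolding K using n0 by (intro mult_right_mono powr_mono cyc_coeff_nonneg divide_right_mono) auto
      finally show "cyc_coeff 0 m i \<le> K * Q" unfolding Q_def .
    qed (use Q in simp)
    also have "\<dots> = K * real b" using Q m S by simp
    finally show ?thesis using S0 by (simp add: \<beta>_def field_simps)
  qed
  have "S \<le> n" using S by simp
  then have "(\<Sum>s\<le>n. t s * max 0 (h s - 1))
      = (\<Sum>s\<le>S. t s * max 0 (h s - 1)) + (\<Sum>s\<in>{S<..n}. t s * max 0 (h s - 1))"
    by (rule sum_atMost_split)
  also have "\<dots> \<le> (4 + 48 * K) * \<beta> + K * \<beta>" by (rule add_mono[OF near far_tail])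
  finally show ?thesis by (simp add: t_def h_def Q_def \<beta>_def algebra_simps)
qed

section \<open>Counting permutations by their cycle lengths\<close>

lemma perm_restrict_orbit_permutes:
  assumes "\<sigma> permutes A" "finite A" 
  shows "perm_restrict \<sigma> (orbit \<sigma> a) permutes orbit \<sigma> a"
proof (rule bij_imp_permutes)
  let ?B = "orbit \<sigma> a"
  have cyc: "cyclic_on \<sigma> ?B" by (rule cyclic_on_orbit[OF assms])
  have "inj_on \<sigma> ?B" by (rule inj_on_subset[OF permutes_inj[OF assms(1)]]) simp
  moreover have "\<sigma> ` ?B \<subseteq> ?B" using cyclic_on_inI[OF cyc] by auto
  ultimately have "bij_betw \<sigma> ?B ?B"
    using finite_cyclic_on[OF cyc] by (simp add: bij_betw_def endo_inj_surj)
  then show "bij_betw (perm_restrict \<sigma> ?B) ?B ?B"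
    by (rule bij_betw_cong[THEN iffD1, rotated]) (simp add: perm_restrict_def)
qed (simp add: perm_restrict_def)

definition cyclic_perms :: "'a set \<Rightarrow> ('a \<Rightarrow> 'a) set" where
  "cyclic_perms B = {\<tau>. \<tau> permutes B \<and> cyclic_on \<tau> B}"

text \<open>
  Permutations of a finite set are counted by splitting off the cycle \<open>B\<close> through a given
  point \<open>a\<close>: a permutation of \<open>A\<close> is the same as a set \<open>B\<close> that contains \<open>a\<close>, a cyclic permutation
  of \<open>B\<close>, and a permutation of \<open>A - B\<close>.
\<close>
lemma sum_perms_by_cycle:
  fixes F :: "'a set set \<Rightarrow> real"
  assumes A: "finite A" and a: "a \<in> A"
  shows "(\<Sum>\<sigma> | \<sigma> permutes A. F (orbit \<sigma> ` A))
    = (\<Sum>B | a \<in> B \<and> B \<subseteq> A. real (card (cyclic_perms B)) *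
         (\<Sum>\<rho> | \<rho> permutes A - B. F (insert B (orbit \<rho> ` (A - B)))))"
proof -
  let ?Bs = "{B. a \<in> B \<and> B \<subseteq> A}"
  let ?T = "Sigma ?Bs (\<lambda>B. cyclic_perms B \<times> {\<rho>. \<rho> permutes A - B})"
  have fin: "finite B" if "B \<in> ?Bs" for B using that A by (auto intro: finite_subset)
  have fincyc: "finite (cyclic_perms B)" if "B \<in> ?Bs" for B
    unfolding cyclic_perms_def by (rule finite_subset[OF _ finite_permutations[OF fin[OF that]]]) auto
  have "(\<Sum>\<sigma> | \<sigma> permutes A. F (orbit \<sigma> ` A))
      = (\<Sum>(B, \<tau>, \<rho>)\<in>?T. F (insert B (orbit \<rho> ` (A - B))))"
  proof (rule sum.reindex_bij_witness[where
        i = "\<lambda>(B, \<tau>, \<rho>). \<tau> \<circ> \<rho>" and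
        j = "\<lambda>\<sigma>. (orbit \<sigma> a, perm_restrict \<sigma> (orbit \<sigma> a), perm_restrict \<sigma> (A - orbit \<sigma> a))"])
    fix \<sigma> assume "\<sigma> \<in> {\<sigma>. \<sigma> permutes A}"
    then have \<sigma>: "\<sigma> permutes A" by simp
    let ?B = "orbit \<sigma> a"
    have cyc: "cyclic_on \<sigma> ?B" by (rule cyclic_on_orbit[OF \<sigma> A])
    have BA: "?B \<subseteq> A" by (rule permutes_orbit_subset[OF \<sigma> a])
    have aB: "a \<in> ?B"
    proof (rule permutation_self_in_orbit)
      show "permutation \<sigma>" using \<sigma> A unfolding permutation_permutes by blast
    qed
    have p1: "perm_restrict \<sigma> ?B permutes ?B" by (rule perm_restrict_orbit_permutes[OF \<sigma> A])
    have p2: "perm_restrict \<sigma> (A - ?B) permutes (A - ?B)"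
      by (rule perm_restrict_diff_cyclic[OF \<sigma> cyc])
    have "perm_restrict \<sigma> ?B \<circ> perm_restrict \<sigma> (A - ?B) = perm_restrict \<sigma> (?B \<union> (A - ?B))"
      by (rule perm_restrict_union[OF p1 p2]) auto
    also have "?B \<union> (A - ?B) = A" using BA by auto
    finally show "(case (?B, perm_restrict \<sigma> ?B, perm_restrict \<sigma> (A - ?B)) of (B, \<tau>, \<rho>) \<Rightarrow> \<tau> \<circ> \<rho>) = \<sigma>"
      by (simp only: prod.case perm_restrict_id[OF \<sigma>])
    show "(?B, perm_restrict \<sigma> ?B, perm_restrict \<sigma> (A - ?B)) \<in> ?T"
      using p1 p2 cyc BA aB by (auto simp: cyclic_perms_def cyclic_on_perm_restrict)
    have "orbit (perm_restrict \<sigma> (A - ?B)) x = orbit \<sigma> x" if x: "x \<in> A - ?B" for x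
    proof -
      let ?\<rho> = "perm_restrict \<sigma> (A - ?B)"
      have "orbit ?\<rho> x \<subseteq> A - ?B" by (rule permutes_orbit_subset[OF p2 x])
      moreover have "x \<in> orbit ?\<rho> x"
      proof (rule permutation_self_in_orbit)
        have "finite (A - ?B)" using A by simp
        then show "permutation ?\<rho>" using p2 unfolding permutation_permutes by blast
      qed
      ultimately show ?thesis
        by (intro orbit_cong[symmetric]) (auto simp: perm_restrict_def)
    qed
    then have "orbit (perm_restrict \<sigma> (A - ?B)) ` (A - ?B) = orbit \<sigma> ` (A - ?B)" by auto
    moreover have "orbit \<sigma> ` A = insert ?B (orbit \<sigma> ` (A - ?B))"
    proof -
      have "A = ?B \<union> (A - ?B)" using BA by blast
      then have "orbit \<sigma> ` A = orbit \<sigma> ` ?B \<union> orbit \<sigma> ` (A - ?B)" by (metis image_Un)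
      moreover have "orbit \<sigma> ` ?B = {?B}"
      proof -
        have "orbit \<sigma> x = ?B" if "x \<in> ?B" for x using that by (rule orbit_cyclic_eq3[OF cyc])
        then show ?thesis using aB by (metis image_constant image_cong)
      qed
      ultimately show ?thesis by simp
    qed
    ultimately show "(case (?B, perm_restrict \<sigma> ?B, perm_restrict \<sigma> (A - ?B)) of
        (B, \<tau>, \<rho>) \<Rightarrow> F (insert B (orbit \<rho> ` (A - B)))) = F (orbit \<sigma> ` A)" by simp
  next
    fix t assume "t \<in> ?T"
    then obtain B \<tau> \<rho> where t: "t = (B, \<tau>, \<rho>)" and B: "a \<in> B" "B \<subseteq> A"
      and \<tau>: "\<tau> permutes B" "cyclic_on \<tau> B" and \<rho>: "\<rho> permutes A - B"
      by (auto simp: cyclic_perms_def)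
    have "cyclic_on (\<tau> \<circ> \<rho>) B"
      by (rule permutes_comp_preserves_cyclic1[OF \<rho> \<tau>(2), of B]) auto
    then have orb: "orbit (\<tau> \<circ> \<rho>) a = B" using B(1) by (rule orbit_cyclic_eq3)
    have r1: "perm_restrict (\<tau> \<circ> \<rho>) B = \<tau>"
    proof
      fix x show "perm_restrict (\<tau> \<circ> \<rho>) B x = \<tau> x"
        using permutes_not_in[OF \<tau>(1), of x] permutes_not_in[OF \<rho>, of x]
        by (cases "x \<in> B") (auto simp: perm_restrict_def)
    qed
    have r2: "perm_restrict (\<tau> \<circ> \<rho>) (A - B) = \<rho>"
    proof
      fix x show "perm_restrict (\<tau> \<circ> \<rho>) (A - B) x = \<rho> x"
        using permutes_not_in[OF \<tau>(1), of "\<rho> x"] permutes_not_in[OF \<rho>, of x] permutes_in_image[OF \<rho>, of x]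
        by (cases "x \<in> A - B") (auto simp: perm_restrict_def)
    qed
    show "(\<lambda>\<sigma>. (orbit \<sigma> a, perm_restrict \<sigma> (orbit \<sigma> a), perm_restrict \<sigma> (A - orbit \<sigma> a)))
        (case t of (B, \<tau>, \<rho>) \<Rightarrow> \<tau> \<circ> \<rho>) = t"
      by (simp add: t orb r1 r2)
    have "\<tau> \<circ> \<rho> permutes A"
      using permutes_compose[OF permutes_subset[OF \<rho>, of A] permutes_subset[OF \<tau>(1) B(2)]] by auto
    then show "(case t of (B, \<tau>, \<rho>) \<Rightarrow> \<tau> \<circ> \<rho>) \<in> {\<sigma>. \<sigma> permutes A}" by (simp add: t)
  qed
  also have "\<dots> = (\<Sum>B\<in>?Bs. \<Sum>(\<tau>, \<rho>)\<in>cyclic_perms B \<times> {\<rho>. \<rho> permutes A - B}. F (insert B (orbit \<rho> ` (A - B))))"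
    by (rule sum.Sigma[symmetric]) (use A fincyc in \<open>auto intro!: finite_cartesian_product finite_permutations\<close>)
  also have "\<dots> = (\<Sum>B\<in>?Bs. real (card (cyclic_perms B)) *
         (\<Sum>\<rho> | \<rho> permutes A - B. F (insert B (orbit \<rho> ` (A - B)))))"
    by (simp add: sum.cartesian_product[symmetric])
  finally show ?thesis .
qed

text \<open>
  There are \<open>n - 1\<close> over \<open>j - 1\<close> sets of size \<open>j\<close> that contain \<open>a\<close>, and the two factorials cancel the
  denominator of this binomial coefficient: every cycle length of \<open>a\<close> is equally likely.
\<close>
lemma sum_subsets_by_card:
  fixes G :: "nat \<Rightarrow> real"
  assumes A: "finite A" and a: "a \<in> A"
  shows "(\<Sum>B | a \<in> B \<and> B \<subseteq> A. fact (card B - 1) * (fact (card A - card B) * G (card B)))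
    = fact (card A - 1) * (\<Sum>j=1..card A. G j)"
proof -
  let ?n = "card A"
  let ?Bs = "{B. a \<in> B \<and> B \<subseteq> A}"
  let ?g = "\<lambda>j. fact (j - 1) * (fact (?n - j) * G j)"
  have fin: "finite B" if "B \<in> ?Bs" for B using that A by (auto intro: finite_subset)
  have "(\<Sum>B\<in>?Bs. ?g (card B)) = (\<Sum>j=1..?n. \<Sum>B | B \<in> ?Bs \<and> card B = j. ?g (card B))"
  proof (rule sum.group[symmetric])
    show "card ` ?Bs \<subseteq> {1..?n}"
      using A fin by (auto simp: card_mono card_gt_0_iff Suc_le_eq)
  qed (use A in auto)
  also have "\<dots> = (\<Sum>j=1..?n. fact (?n - 1) * G j)"
  proof (rule sum.cong[OF refl])
    fix j assume j: "j \<in> {1..?n}"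
    have "bij_betw (insert a) {C. C \<subseteq> A - {a} \<and> card C = j - 1} {B. B \<in> ?Bs \<and> card B = j}"
    proof (rule bij_betw_byWitness[where f' = "\<lambda>B. B - {a}"])
      show "insert a ` {C. C \<subseteq> A - {a} \<and> card C = j - 1} \<subseteq> {B. B \<in> ?Bs \<and> card B = j}"
      proof clarify
        fix C assume C: "C \<subseteq> A - {a}" "card C = j - 1"
        then have "finite C" "a \<notin> C" using A by (auto intro: finite_subset)
        then show "insert a C \<in> ?Bs \<and> card (insert a C) = j" using C a j by auto
      qed
      show "(\<lambda>B. B - {a}) ` {B. B \<in> ?Bs \<and> card B = j} \<subseteq> {C. C \<subseteq> A - {a} \<and> card C = j - 1}"
        by (auto simp: card_Diff_singleton)
    qed auto
    then have "card {B. B \<in> ?Bs \<and> card B = j} = card {C. C \<subseteq> A - {a} \<and> card C = j - 1}"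
      by (simp add: bij_betw_same_card)
    also have "\<dots> = (?n - 1) choose (j - 1)" using A a by (simp add: n_subsets)
    finally have c: "card {B. B \<in> ?Bs \<and> card B = j} = (?n - 1) choose (j - 1)" .
    have "real ((?n - 1) choose (j - 1)) = fact (?n - 1) / (fact (j - 1) * fact (?n - 1 - (j - 1)))"
      by (rule binomial_fact) (use j in auto)
    moreover have "?n - 1 - (j - 1) = ?n - j" using j by auto
    ultimately have b: "real ((?n - 1) choose (j - 1)) * (fact (j - 1) * fact (?n - j)) = fact (?n - 1)"
      by simp
    have "(\<Sum>B | B \<in> ?Bs \<and> card B = j. ?g (card B)) = (\<Sum>B | B \<in> ?Bs \<and> card B = j. ?g j)"
      by (rule sum.cong) auto
    also have "\<dots> = real ((?n - 1) choose (j - 1)) * ?g j" unfolding sum_constant c ..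
    also have "\<dots> = fact (?n - 1) * G j" unfolding b[symmetric] by (simp only: mult.assoc)
    finally show "(\<Sum>B | B \<in> ?Bs \<and> card B = j. ?g (card B)) = fact (?n - 1) * G j" .
  qed
  finally show ?thesis by (simp add: sum_distrib_left)
qed

text \<open>
  The decomposition applied to the constant \<open>1\<close> determines these numbers recursively:
  it writes \<open>n!\<close> as a sum in which the set \<open>B = A\<close> contributes the unknown number, and if the
  formula holds for all smaller sets then it has to hold for \<open>A\<close> because \<open>n! = n * (n - 1)!\<close>.
\<close>
lemma card_cyclic_perms:
  assumes "finite A" "A \<noteq> {}"
  shows "card (cyclic_perms A) = fact (card A - 1)"
  using assms
proof (induction "card A" arbitrary: A rule: less_induct)
  case less
  from less.prems obtain a where a: "a \<in> A" by auto
  let ?Bs = "{B. a \<in> B \<and> B \<subseteq> A}" and ?n = "card A"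
  let ?g = "\<lambda>B. fact (card B - 1) * (fact (?n - card B) * 1) :: real"
  have finBs: "finite ?Bs" using less.prems by auto
  have ABs: "A \<in> ?Bs" using a by auto
  have "fact ?n = (\<Sum>\<sigma> | \<sigma> permutes A. (\<lambda>_. 1 :: real) (orbit \<sigma> ` A))"
    using less.prems by (simp add: card_permutations)
  also have "\<dots> = (\<Sum>B\<in>?Bs. real (card (cyclic_perms B)) * fact (card (A - B)))"
    using less.prems by (subst sum_perms_by_cycle[OF less.prems(1) a]) (simp add: card_permutations)
  also have "\<dots> = real (card (cyclic_perms A))
      + (\<Sum>B\<in>?Bs - {A}. real (card (cyclic_perms B)) * fact (card (A - B)))"
    by (subst sum.remove[OF finBs ABs]) simp
  also have "(\<Sum>B\<in>?Bs - {A}. real (card (cyclic_perms B)) * fact (card (A - B))) = (\<Sum>B\<in>?Bs - {A}. ?g B)"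
  proof (rule sum.cong[OF refl])
    fix B assume B: "B \<in> ?Bs - {A}"
    then have "B \<subset> A" by auto
    then have "card B < ?n" "finite B" "B \<noteq> {}"
      using less.prems B by (auto intro: psubset_card_mono finite_subset)
    then show "real (card (cyclic_perms B)) * fact (card (A - B)) = ?g B"
      using less.hyps[of B] B by (simp add: card_Diff_subset)
  qed
  also have "\<dots> = (\<Sum>B\<in>?Bs. ?g B) - fact (?n - 1)"
    using sum.remove[OF finBs ABs, of ?g] by simp
  also have "(\<Sum>B\<in>?Bs. ?g B) = fact (?n - 1) * real ?n"
    by (subst sum_subsets_by_card[OF less.prems(1) a]) simp
  also have "fact (?n - 1) * real ?n = fact ?n"
    using less.prems by (cases ?n) (auto simp: algebra_simps)
  finally have "real (card (cyclic_perms A)) = fact (?n - 1)" by simp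
  then show ?case using of_nat_eq_iff[where ?'a = real] by fastforce
qed

lemma sum_perms_recurrence:
  fixes F :: "'a set set \<Rightarrow> real" and G :: "nat \<Rightarrow> real"
  assumes A: "finite A" "A \<noteq> {}"
    and rest: "\<And>B. B \<noteq> {} \<Longrightarrow> B \<subseteq> A \<Longrightarrow>
      (\<Sum>\<rho> | \<rho> permutes A - B. F (insert B (orbit \<rho> ` (A - B)))) = fact (card A - card B) * G (card B)"
  shows "(\<Sum>\<sigma> | \<sigma> permutes A. F (orbit \<sigma> ` A)) = fact (card A - 1) * (\<Sum>j=1..card A. G j)"
proof -
  from A obtain a where a: "a \<in> A" by auto
  have "(\<Sum>\<sigma> | \<sigma> permutes A. F (orbit \<sigma> ` A))
    = (\<Sum>B | a \<in> B \<and> B \<subseteq> A. fact (card B - 1) * (fact (card A - card B) * G (card B)))"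
    unfolding sum_perms_by_cycle[OF A(1) a]
  proof (rule sum.cong[OF refl])
    fix B assume "B \<in> {B. a \<in> B \<and> B \<subseteq> A}"
    then have B: "B \<noteq> {}" "B \<subseteq> A" "finite B" using A by (auto intro: finite_subset)
    show "real (card (cyclic_perms B)) * (\<Sum>\<rho> | \<rho> permutes A - B. F (insert B (orbit \<rho> ` (A - B))))
       = fact (card B - 1) * (fact (card A - card B) * G (card B))"
      using rest[OF B(1,2)] card_cyclic_perms[OF B(3,1)] by simp
  qed
  then show ?thesis using sum_subsets_by_card[OF A(1) a] by simp
qed

text \<open>
  The argument \<open>\<C>\<close> stands for the set of cycles of a permutation. For \<open>b = 0\<close> only the
  bound \<open>m\<close> on the lengths remains, which gives the normalising constant.
\<close>
definition has_cycle_counts :: "nat \<Rightarrow> nat \<Rightarrow> (nat \<Rightarrow> nat) \<Rightarrow> 'a set set \<Rightarrow> bool" where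
  "has_cycle_counts m b c \<C> \<longleftrightarrow>
     (\<forall>C\<in>\<C>. card C \<le> m) \<and> (\<forall>j\<in>{1..b}. card {C\<in>\<C>. card C = j} = c j)"

text \<open>
  The product in Cauchy's formula for the number of permutations of a given cycle type.
\<close>
definition cauchy_weight :: "nat \<Rightarrow> (nat \<Rightarrow> nat) \<Rightarrow> real" where
  "cauchy_weight b c = (\<Prod>j=1..b. (1 / real j) ^ c j / fact (c j))"

definition total_size :: "nat \<Rightarrow> (nat \<Rightarrow> nat) \<Rightarrow> nat" where
  "total_size b c = (\<Sum>j=1..b. j * c j)"

lemma cauchy_weight_decr:
  assumes "j \<in> {1..b}" "1 \<le> c j"
  shows "cauchy_weight b (c(j := c j - 1)) = real j * real (c j) * cauchy_weight b c"
proof -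
  let ?f = "\<lambda>c i. (1 / real i) ^ c i / fact (c i) :: real"
  have "cauchy_weight b (c(j := c j - 1)) = ?f (c(j := c j - 1)) j * (\<Prod>i\<in>{1..b}-{j}. ?f (c(j := c j - 1)) i)"
    unfolding cauchy_weight_def using assms by (intro prod.remove) auto
  also have "(\<Prod>i\<in>{1..b}-{j}. ?f (c(j := c j - 1)) i) = (\<Prod>i\<in>{1..b}-{j}. ?f c i)"
    by (rule prod.cong) auto
  also have "?f (c(j := c j - 1)) j = real j * real (c j) * ?f c j"
  proof -
    obtain k where k: "c j = Suc k" using assms by (cases "c j") auto
    have "(real j * real (Suc k)) * ((1 / real j) ^ Suc k / fact (Suc k))
       = (real j * (1 / real j)) * (1 / real j) ^ k * (real (Suc k) / fact (Suc k))"
      by (simp only: power_Suc times_divide_eq_right mult_ac) simp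
    also have "\<dots> = (1 / real j) ^ k / fact k"
      using assms by (simp add: divide_simps del: of_nat_Suc)
    finally show ?thesis unfolding k by simp
  qed
  also have "real j * real (c j) * ?f c j * (\<Prod>i\<in>{1..b}-{j}. ?f c i) = real j * real (c j) * cauchy_weight b c"
    unfolding cauchy_weight_def using assms by (subst prod.remove[of "{1..b}" j]) (auto simp: mult_ac)
  finally show ?thesis .
qed

lemma total_size_decr:
  assumes "j \<in> {1..b}" "1 \<le> c j"
  shows "total_size b c = total_size b (c(j := c j - 1)) + j"
proof -
  have "total_size b (c(j := c j - 1)) = j * (c j - 1) + (\<Sum>i\<in>{1..b}-{j}. i * (c(j := c j - 1)) i)"
    unfolding total_size_def using assms by (subst sum.remove[of _ j]) auto
  also have "(\<Sum>i\<in>{1..b}-{j}. i * (c(j := c j - 1)) i) = (\<Sum>i\<in>{1..b}-{j}. i * c i)"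
    by (rule sum.cong) auto
  finally have 1: "total_size b (c(j := c j - 1)) = j * (c j - 1) + (\<Sum>i\<in>{1..b}-{j}. i * c i)" .
  have 2: "total_size b c = j * c j + (\<Sum>i\<in>{1..b}-{j}. i * c i)"
    unfolding total_size_def using assms by (subst sum.remove[of _ j]) auto
  obtain k where "c j = Suc k" using assms by (cases "c j") auto
  then show ?thesis unfolding 1 2 by simp
qed

lemma has_cycle_counts_insert:
  assumes "finite \<C>" "B \<notin> \<C>" "1 \<le> card B" "b \<le> m"
  shows "has_cycle_counts m b c (insert B \<C>) \<longleftrightarrow> card B \<le> m \<and>
    (if card B \<le> b then 1 \<le> c (card B) \<and> has_cycle_counts m b (c(card B := c (card B) - 1)) \<C>
     else has_cycle_counts m b c \<C>)"
proof -
  have card: "card {C \<in> insert B \<C>. card C = j} = card {C\<in>\<C>. card C = j} + (if j = card B then 1 else 0)" for j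
  proof (cases "j = card B")
    case True
    then have "{C \<in> insert B \<C>. card C = j} = insert B {C\<in>\<C>. card C = j}" by auto
    then show ?thesis using assms True by simp
  next
    case False
    then have "{C \<in> insert B \<C>. card C = j} = {C\<in>\<C>. card C = j}" by auto
    then show ?thesis using False by simp
  qed
  have *: "(\<forall>j\<in>{1..b}. card {C \<in> insert B \<C>. card C = j} = c j) \<longleftrightarrow>
     (if card B \<le> b then 1 \<le> c (card B) \<and> (\<forall>j\<in>{1..b}. card {C\<in>\<C>. card C = j} = (c(card B := c (card B) - 1)) j)
      else (\<forall>j\<in>{1..b}. card {C\<in>\<C>. card C = j} = c j))"
    unfolding card using assms by (auto split: if_splits)
  show ?thesis unfolding has_cycle_counts_def * by auto
qed


text \<open>
  Both sides satisfy the same recurrence in the size \<open>n\<close> of \<open>A\<close>. Let \<open>s = total_size b c\<close>. If the cycle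
  of a given point has length \<open>j \<le> b\<close>, then the counts of the rest are \<open>c\<close> lowered by one at \<open>j\<close>, and
  Cauchy's weight changes by the factor \<open>j * c j\<close>; these factors add up to \<open>s\<close>. The lengths
  \<open>j > b\<close> contribute a window of \<open>cyc_coeff b m\<close> that sums to \<open>n - s\<close> times its value at \<open>n - s\<close>.
  Together they give the factor \<open>n\<close>.
\<close>
lemma sum_perms_cycle_counts:
  assumes A: "finite A" and b: "b \<le> m"
  shows "(\<Sum>\<sigma> | \<sigma> permutes A. of_bool (has_cycle_counts m b c (orbit \<sigma> ` A)))
    = fact (card A) * (cauchy_weight b c * (if total_size b c \<le> card A then cyc_coeff b m (card A - total_size b c) else 0))"
  using A
proof (induction "card A" arbitrary: A c rule: less_induct)
  case less
  note A = less.prems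
  let ?n = "card A" and ?s = "total_size b c"
  show ?case
  proof (cases "A = {}")
    case True
    have "(\<forall>j\<in>{1..b}. c j = 0) \<longleftrightarrow> ?s = 0" by (auto simp: total_size_def)
    moreover have "cauchy_weight b c = 1" if "\<forall>j\<in>{1..b}. c j = 0" using that by (simp add: cauchy_weight_def)
    ultimately show ?thesis using True by (auto simp: has_cycle_counts_def)
  next
    case False
    define G where "G j = (if j \<le> b then real j * real (c j) * cauchy_weight b c * (if ?s \<le> ?n then cyc_coeff b m (?n - ?s) else 0)
       else if j \<le> m then cauchy_weight b c * (if ?s \<le> ?n - j then cyc_coeff b m (?n - j - ?s) else 0) else 0)" for j
    have "(\<Sum>\<sigma> | \<sigma> permutes A. of_bool (has_cycle_counts m b c (orbit \<sigma> ` A))) = fact (?n - 1) * (\<Sum>j=1..?n. G j)"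
    proof (rule sum_perms_recurrence[OF A False])
      fix B assume B: "B \<noteq> {}" "B \<subseteq> A"
      let ?j = "card B"
      have fB: "finite B" using B A by (auto intro: finite_subset)
      have j1: "1 \<le> ?j" using B fB by (simp add: card_gt_0_iff Suc_le_eq)
      have jn: "?j \<le> ?n" using B A by (simp add: card_mono)
      have cAB: "card (A - B) = ?n - ?j" using B fB by (simp add: card_Diff_subset)
      have lt: "card (A - B) < ?n" using cAB j1 jn by simp
      have IH: "(\<Sum>\<rho> | \<rho> permutes A - B. of_bool (has_cycle_counts m b c' (orbit \<rho> ` (A - B))))
        = fact (?n - ?j) * (cauchy_weight b c' * (if total_size b c' \<le> ?n - ?j then cyc_coeff b m (?n - ?j - total_size b c') else 0))" for c'
        using less.hyps[OF lt, of c'] A unfolding cAB by simp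
      have ins: "has_cycle_counts m b c (insert B (orbit \<rho> ` (A - B))) \<longleftrightarrow> ?j \<le> m \<and>
          (if ?j \<le> b then 1 \<le> c ?j \<and> has_cycle_counts m b (c(?j := c ?j - 1)) (orbit \<rho> ` (A - B))
           else has_cycle_counts m b c (orbit \<rho> ` (A - B)))" if \<rho>: "\<rho> permutes A - B" for \<rho>
      proof (rule has_cycle_counts_insert[OF _ _ j1 b])
        show "finite (orbit \<rho> ` (A - B))" using A by simp
        show "B \<notin> orbit \<rho> ` (A - B)"
          using permutes_orbit_subset[OF \<rho>] B(1) by fastforce
      qed
      have "(\<Sum>\<rho> | \<rho> permutes A - B. of_bool (has_cycle_counts m b c (insert B (orbit \<rho> ` (A - B)))))
        = (\<Sum>\<rho> | \<rho> permutes A - B. of_bool (?j \<le> m \<and>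
          (if ?j \<le> b then 1 \<le> c ?j \<and> has_cycle_counts m b (c(?j := c ?j - 1)) (orbit \<rho> ` (A - B))
           else has_cycle_counts m b c (orbit \<rho> ` (A - B)))))" (is "?L = _")
        by (rule sum.cong) (simp_all add: ins)
      also have "\<dots> = fact (?n - ?j) * G ?j"
      proof (cases "?j \<le> b")
        case True
        show ?thesis
        proof (cases "1 \<le> c ?j")
          case c1: True
          have jb: "?j \<in> {1..b}" using True j1 by simp
          define c' where "c' = c(?j := c ?j - 1)"
          have s: "?s = total_size b c' + ?j"
            unfolding c'_def by (rule total_size_decr[of "card B" b c, OF jb c1])
          have w: "cauchy_weight b c' = real ?j * real (c ?j) * cauchy_weight b c"
            unfolding c'_def by (rule cauchy_weight_decr[of "card B" b c, OF jb c1])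
          have le: "total_size b c' \<le> ?n - ?j \<longleftrightarrow> ?s \<le> ?n" using s jn by linarith
          have eq: "?n - ?j - total_size b c' = ?n - ?s" using s by linarith
          have jm: "?j \<le> m" using True b by simp
          have "(\<Sum>\<rho> | \<rho> permutes A - B. of_bool (?j \<le> m \<and>
              (if ?j \<le> b then 1 \<le> c ?j \<and> has_cycle_counts m b c' (orbit \<rho> ` (A - B))
               else has_cycle_counts m b c (orbit \<rho> ` (A - B)))) :: real)
            = (\<Sum>\<rho> | \<rho> permutes A - B. of_bool (has_cycle_counts m b c' (orbit \<rho> ` (A - B))))"
            by (simp only: True c1 jm if_True simp_thms)
          also have "\<dots> = fact (?n - ?j) * G ?j"
            unfolding IH[of c'] w le eq G_def by (simp only: True if_True)
          finally show ?thesis unfolding c'_def .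
        next
          case False
          then show ?thesis using True by (simp add: G_def)
        qed
      next
        case False
        then show ?thesis using IH[of c] by (simp add: G_def)
      qed
      finally show "?L = fact (?n - ?j) * G ?j" .
    qed
    also have "(\<Sum>j=1..?n. G j) = real ?n * (cauchy_weight b c * (if ?s \<le> ?n then cyc_coeff b m (?n - ?s) else 0))"
    proof (cases "?s \<le> ?n")
      case False
      then have "\<not> ?s \<le> ?n - j" for j by linarith
      then have "G j = 0" for j using False by (simp only: G_def if_False mult_zero_right if_cancel)
      then show ?thesis using False by simp
    next
      case True
      let ?u = "cyc_coeff b m (?n - ?s)"
      have small: "c j = 0" if "j \<in> {1..b}" "?n < j" for j
      proof (rule ccontr)
        assume "c j \<noteq> 0"
        then have "j \<le> ?s" using total_size_decr[of j b c] that by simp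
        then show False using True that by simp
      qed
      have "(\<Sum>j=1..?n. G j) = (\<Sum>j\<in>{j\<in>{1..?n}. j \<le> b}. G j) + (\<Sum>j\<in>{j\<in>{1..?n}. \<not> j \<le> b}. G j)"
      proof -
        have "sum G {1..?n} = sum G ({j\<in>{1..?n}. j \<le> b} \<union> {j\<in>{1..?n}. \<not> j \<le> b})"
          by (rule arg_cong[where f = "sum G"]) blast
        also have "sum G ({j\<in>{1..?n}. j \<le> b} \<union> {j\<in>{1..?n}. \<not> j \<le> b})
            = sum G {j\<in>{1..?n}. j \<le> b} + sum G {j\<in>{1..?n}. \<not> j \<le> b}"
          by (rule sum.union_disjoint) auto
        finally show ?thesis .
      qed
      also have "(\<Sum>j\<in>{j\<in>{1..?n}. j \<le> b}. G j) = (\<Sum>j\<in>{j\<in>{1..?n}. j \<le> b}. real (j * c j) * (cauchy_weight b c * ?u))"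
        by (rule sum.cong) (auto simp: G_def True)
      also have "\<dots> = (\<Sum>j=1..b. real (j * c j) * (cauchy_weight b c * ?u))"
      proof (rule sum.mono_neutral_left)
        show "\<forall>j\<in>{1..b} - {j\<in>{1..?n}. j \<le> b}. real (j * c j) * (cauchy_weight b c * ?u) = 0"
        proof
          fix j assume "j \<in> {1..b} - {j\<in>{1..?n}. j \<le> b}"
          then have "c j = 0" by (intro small) auto
          then show "real (j * c j) * (cauchy_weight b c * ?u) = 0" by simp
        qed
      qed auto
      also have "\<dots> = real ?s * (cauchy_weight b c * ?u)"
        by (simp add: total_size_def sum_distrib_right)
      also have "(\<Sum>j\<in>{j\<in>{1..?n}. \<not> j \<le> b}. G j)
          = (\<Sum>j\<in>{j\<in>{b<..m}. j \<le> ?n - ?s}. cauchy_weight b c * cyc_coeff b m (?n - ?s - j))"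
        by (rule sum.mono_neutral_cong_right) (use True in \<open>auto simp: G_def diff_commute add.commute\<close>)
      also have "\<dots> = cauchy_weight b c * (\<Sum>j\<in>{j\<in>{b<..m}. j \<le> ?n - ?s}. cyc_coeff b m (?n - ?s - j))"
        by (rule sum_distrib_left[symmetric])
      also have "(\<Sum>j\<in>{j\<in>{b<..m}. j \<le> ?n - ?s}. cyc_coeff b m (?n - ?s - j)) = (\<Sum>i\<in>{?n-?s-m..<?n-?s-b}. cyc_coeff b m i)"
        by (rule sum.reindex_bij_witness[where i = "\<lambda>i. ?n - ?s - i" and j = "\<lambda>j. ?n - ?s - j"]) auto
      also have "\<dots> = real (?n - ?s) * ?u" by (rule cyc_coeff_window[symmetric])
      finally show ?thesis using True by (simp add: algebra_simps of_nat_diff)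
    qed
    also have "fact (?n - 1) * (real ?n * (cauchy_weight b c * (if ?s \<le> ?n then cyc_coeff b m (?n - ?s) else 0)))
       = (fact (?n - 1) * real ?n) * (cauchy_weight b c * (if ?s \<le> ?n then cyc_coeff b m (?n - ?s) else 0))"
      by (simp only: mult.assoc)
    also have "fact (?n - 1) * real ?n = fact ?n"
      using False A by (cases ?n) (auto simp: algebra_simps)
    finally show ?thesis .
  qed
qed

section \<open>Cycle counts against Poisson variables\<close>

lemma pmf_poisson_vector:
  "pmf (poisson_vector_pmf b) c =
     (if \<forall>x. x \<notin> {1..b} \<longrightarrow> c x = 0 then cauchy_weight b c / exp (\<Sum>j=1..b. 1 / real j) else 0)"
proof -
  have "(\<Prod>j=1..b. pmf (poisson_pmf (1 / real j)) (c j))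
      = (\<Prod>j=1..b. ((1 / real j) ^ c j / fact (c j)) * exp (- (1 / real j)))"
    by (intro prod.cong refl, subst pmf_poisson) auto
  also have "\<dots> = cauchy_weight b c * (\<Prod>j=1..b. exp (- (1 / real j)))"
    unfolding cauchy_weight_def by (rule prod.distrib)
  also have "(\<Prod>j=1..b. exp (- (1 / real j))) = exp (- (\<Sum>j=1..b. 1 / real j))"
    by (simp add: exp_sum sum_negf[symmetric])
  finally show ?thesis
    unfolding poisson_vector_pmf_def by (subst pmf_Pi) (auto simp: exp_minus divide_inverse)
qed

definition count_vectors :: "nat \<Rightarrow> nat \<Rightarrow> (nat \<Rightarrow> nat) set" where
  "count_vectors b s = {c. (\<forall>x. x \<notin> {1..b} \<longrightarrow> c x = 0) \<and> total_size b c = s}"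

lemma total_size_ge: assumes "j \<in> {1..b}" shows "j * c j \<le> total_size b c"
  unfolding total_size_def by (rule member_le_sum) (use assms in auto)

lemma finite_count_vectors: "finite (count_vectors b s)"
proof (rule finite_subset)
  show "count_vectors b s \<subseteq> {f. \<forall>x. (x \<in> {1..b} \<longrightarrow> f x \<in> {..s}) \<and> (x \<notin> {1..b} \<longrightarrow> f x = 0)}"
  proof clarify
    fix c x assume c: "c \<in> count_vectors b s"
    have "c x \<le> s" if x: "x \<in> {1..b}"
    proof -
      have "1 * c x \<le> x * c x" using x by (intro mult_right_mono) auto
      also have "\<dots> \<le> s" using total_size_ge[OF x, of c] c by (simp add: count_vectors_def)
      finally show ?thesis by simp
    qed
    then show "(x \<in> {1..b} \<longrightarrow> c x \<in> {..s}) \<and> (x \<notin> {1..b} \<longrightarrow> c x = 0)"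
      using c by (auto simp: count_vectors_def)
  qed
qed (rule finite_set_of_finite_funs; simp)

text \<open>
  Lowering one entry of \<open>c\<close> yields the window recursion for the left-hand side as well. After
  division by \<open>exp (\<Sum>j=1..b. 1 / j)\<close> this identifies the law of \<open>T\<close>.
\<close>
lemma sum_cauchy_weight: "(\<Sum>c\<in>count_vectors b k. cauchy_weight b c) = cyc_coeff 0 b k"
proof (rule cyc_coeff_unique[of "\<lambda>k. \<Sum>c\<in>count_vectors b k. cauchy_weight b c"])
  have "c = (\<lambda>_. 0)" if c: "c \<in> count_vectors b 0" for c
  proof
    fix x show "c x = 0"
      using total_size_ge[of x b c] c by (cases "x \<in> {1..b}") (auto simp: count_vectors_def)
  qed
  then have "count_vectors b 0 = {\<lambda>_. 0}" by (auto simp: count_vectors_def total_size_def)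
  then show "(\<Sum>c\<in>count_vectors b 0. cauchy_weight b c) = 1" by (simp add: cauchy_weight_def)
next
  fix k :: nat
  have "real k * (\<Sum>c\<in>count_vectors b k. cauchy_weight b c) = (\<Sum>c\<in>count_vectors b k. \<Sum>j=1..b. real j * real (c j) * cauchy_weight b c)"
    unfolding sum_distrib_left
  proof (rule sum.cong[OF refl])
    fix c assume "c \<in> count_vectors b k"
    then have "k = total_size b c" by (simp add: count_vectors_def)
    then show "real k * cauchy_weight b c = (\<Sum>j=1..b. real j * real (c j) * cauchy_weight b c)"
      by (simp add: total_size_def sum_distrib_right)
  qed
  also have "\<dots> = (\<Sum>j=1..b. \<Sum>c\<in>count_vectors b k. real j * real (c j) * cauchy_weight b c)"
    by (rule sum.swap)
  also have "\<dots> = (\<Sum>j=1..b. if j \<le> k then \<Sum>c\<in>count_vectors b (k - j). cauchy_weight b c else 0)"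
  proof (rule sum.cong[OF refl])
    fix j assume j: "j \<in> {1..b}"
    show "(\<Sum>c\<in>count_vectors b k. real j * real (c j) * cauchy_weight b c) = (if j \<le> k then \<Sum>c\<in>count_vectors b (k - j). cauchy_weight b c else 0)"
    proof (cases "j \<le> k")
      case False
      have "c j = 0" if "c \<in> count_vectors b k" for c
      proof (rule ccontr)
        assume "c j \<noteq> 0"
        then have "j * 1 \<le> j * c j" by (intro mult_left_mono) auto
        also have "\<dots> \<le> k" using total_size_ge[OF j, of c] that by (simp add: count_vectors_def)
        finally show False using False by simp
      qed
      then have "(\<Sum>c\<in>count_vectors b k. real j * real (c j) * cauchy_weight b c) = 0" by (intro sum.neutral) simp
      then show ?thesis using False by simp
    next
      case True
      have "(\<Sum>c\<in>count_vectors b k. real j * real (c j) * cauchy_weight b c)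
          = (\<Sum>c\<in>{c\<in>count_vectors b k. 1 \<le> c j}. real j * real (c j) * cauchy_weight b c)"
        by (rule sum.mono_neutral_right) (auto simp: finite_count_vectors)
      also have "\<dots> = (\<Sum>c\<in>count_vectors b (k - j). cauchy_weight b c)"
      proof (rule sum.reindex_bij_witness[where i = "\<lambda>c. c(j := c j + 1)" and j = "\<lambda>c. c(j := c j - 1)"])
        fix c assume c: "c \<in> {c\<in>count_vectors b k. 1 \<le> c j}"
        show "(c(j := c j - 1))(j := (c(j := c j - 1)) j + 1) = c" using c by (auto simp: fun_eq_iff)
        show "c(j := c j - 1) \<in> count_vectors b (k - j)"
          using c total_size_decr[of j b c, OF j] by (auto simp: count_vectors_def)
        show "cauchy_weight b (c(j := c j - 1)) = real j * real (c j) * cauchy_weight b c"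
          using c by (intro cauchy_weight_decr j) simp
      next
        fix c assume c: "c \<in> count_vectors b (k - j)"
        show "(c(j := c j + 1))(j := (c(j := c j + 1)) j - 1) = c" by (auto simp: fun_eq_iff)
        have "total_size b (c(j := c j + 1)) = total_size b c + j"
          using total_size_decr[of j b "c(j := c j + 1)", OF j] by simp
        then show "c(j := c j + 1) \<in> {c\<in>count_vectors b k. 1 \<le> c j}"
          using c True j by (auto simp: count_vectors_def)
      qed
      finally show ?thesis using True by simp
    qed
  qed
  also have "\<dots> = (\<Sum>j\<in>{j\<in>{1..b}. j \<le> k}. \<Sum>c\<in>count_vectors b (k - j). cauchy_weight b c)"
    by (rule sum.inter_filter[symmetric]) simp
  also have "\<dots> = (\<Sum>i\<in>{k-b..<k-0}. \<Sum>c\<in>count_vectors b i. cauchy_weight b c)"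
    by (rule sum.reindex_bij_witness[where i = "\<lambda>i. k - i" and j = "\<lambda>j. k - j"]) auto
  finally show "real k * (\<Sum>c\<in>count_vectors b k. cauchy_weight b c) = (\<Sum>i\<in>{k-b..<k-0}. \<Sum>c\<in>count_vectors b i. cauchy_weight b c)" .
qed

lemma pmf_has_sum: "(pmf p has_sum 1) UNIV"
proof -
  have "infsum (pmf p) UNIV = 1"
    using infsetsum_infsum[OF pmf_abs_summable, of p UNIV] infsetsum_pmf_eq_1[of p UNIV] by simp
  moreover have "pmf p summable_on UNIV"
    using abs_summable_equivalent[of "pmf p" UNIV] pmf_abs_summable[of p UNIV]
    by (auto dest: summable_on_iff_abs_summable_on_real[THEN iffD2])
  ultimately show ?thesis by (metis has_sum_infsum)
qed

text \<open>
  The coefficients, divided by the claimed sum, are the probabilities of the values of \<open>T\<close>.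
\<close>
lemma cyc_coeff_sums: "(cyc_coeff 0 b) sums exp (\<Sum>j=1..b. 1 / real j)"
proof -
  let ?Z = "exp (\<Sum>j=1..b. 1 / real j)" and ?p = "poisson_vector_pmf b"
  have "pmf (map_pmf (total_size b) ?p) k = cyc_coeff 0 b k / ?Z" for k
  proof -
    have "pmf (map_pmf (total_size b) ?p) k = measure ?p (total_size b -` {k})" by (rule pmf_map)
    also have "\<dots> = measure ?p (count_vectors b k)"
    proof (rule measure_pmf.finite_measure_eq_AE)
      show "AE c in measure_pmf ?p. (c \<in> total_size b -` {k}) = (c \<in> count_vectors b k)"
        by (auto simp: AE_measure_pmf_iff set_pmf_iff pmf_poisson_vector count_vectors_def split: if_splits)
    qed auto
    also have "\<dots> = (\<Sum>c\<in>count_vectors b k. cauchy_weight b c / ?Z)"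
      unfolding measure_measure_pmf_finite[OF finite_count_vectors]
      by (intro sum.cong refl) (auto simp: pmf_poisson_vector count_vectors_def)
    also have "\<dots> = cyc_coeff 0 b k / ?Z" by (simp add: sum_divide_distrib[symmetric] sum_cauchy_weight)
    finally show ?thesis .
  qed
  then have "pmf (map_pmf (total_size b) ?p) = (\<lambda>k. cyc_coeff 0 b k / ?Z)" by (rule ext)
  then have "(\<lambda>k. cyc_coeff 0 b k / ?Z) sums 1"
    using has_sum_imp_sums[OF pmf_has_sum[of "map_pmf (total_size b) ?p"]] by (simp only:)
  from sums_mult2[OF this, of ?Z] show ?thesis by simp
qed

lemma pmf_cycle_count:
  assumes \<alpha>: "1 \<le> \<alpha> n" and m: "m = nat \<lfloor>\<alpha> n\<rfloor>" and b: "b \<le> m"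
    and c: "\<forall>x. x \<notin> {1..b} \<longrightarrow> c x = 0"
  shows "pmf (cycle_count_pmf n b \<alpha>) c
     = cauchy_weight b c * (if total_size b c \<le> n then cyc_coeff b m (n - total_size b c) else 0) / cyc_coeff 0 m n"
proof -
  let ?S = "short_cycle_perms n \<alpha>" and ?P = "{\<sigma>. \<sigma> permutes {1..n}}"
  let ?f = "\<lambda>\<sigma> m. if m \<in> {1..b} then cycle_count n m \<sigma> else 0"
  let ?\<C> = "\<lambda>\<sigma>. orbit \<sigma> ` {1..n}"
  have finP: "finite ?P" by (simp add: finite_permutations)
  have le: "real k \<le> \<alpha> n \<longleftrightarrow> k \<le> m" for k
    using \<alpha> unfolding m by (simp add: le_nat_iff le_floor_iff)
  have S: "?S = {\<sigma>\<in>?P. has_cycle_counts m 0 c (?\<C> \<sigma>)}"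
    by (auto simp: short_cycle_perms_def cycles_of_perm_def has_cycle_counts_def le)
  have Sc: "?S \<inter> (?f -` {c}) = {\<sigma>\<in>?P. has_cycle_counts m b c (?\<C> \<sigma>)}"
    using c by (auto simp: short_cycle_perms_def cycles_of_perm_def has_cycle_counts_def le cycle_count_def fun_eq_iff)
  have card: "real (card {\<sigma>\<in>?P. Q \<sigma>}) = (\<Sum>\<sigma>\<in>?P. of_bool (Q \<sigma>))" for Q
    using finP by (simp add: sum.If_cases Int_def of_bool_def)
  have cS: "real (card ?S) = fact n * cyc_coeff 0 m n"
    unfolding S card by (subst sum_perms_cycle_counts) (simp_all add: cauchy_weight_def total_size_def)
  have cSc: "real (card (?S \<inter> (?f -` {c}))) = fact n *
      (cauchy_weight b c * (if total_size b c \<le> n then cyc_coeff b m (n - total_size b c) else 0))"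
    unfolding Sc card by (subst sum_perms_cycle_counts[OF _ b]) simp_all
  have "pmf (cycle_count_pmf n b \<alpha>) c = measure (pmf_of_set ?S) (?f -` {c})"
    unfolding cycle_count_pmf_def perm_pmf_def by (rule pmf_map)
  also have "\<dots> = real (card (?S \<inter> (?f -` {c}))) / real (card ?S)"
    by (rule measure_pmf_of_set) (use short_cycle_perms_nonempty[of \<alpha> n, OF \<alpha>] finite_short_cycle_perms in auto)
  finally show ?thesis unfolding cS cSc by simp
qed

text \<open>
  The density of the cycle counts with respect to the Poisson vector depends on the vector
  \<open>c\<close> only through its total size \<open>s\<close>, so the sum over vectors reduces to a sum over \<open>s\<close>.
\<close>
lemma tv_dist_eq:
  assumes \<alpha>: "1 \<le> \<alpha> n" and m: "m = nat \<lfloor>\<alpha> n\<rfloor>" and b: "b \<le> m"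
    and Z: "Z = exp (\<Sum>j=1..b. 1 / real j)"
  shows "tv_dist (cycle_count_pmf n b \<alpha>) (poisson_vector_pmf b)
    = (\<Sum>s\<le>n. cyc_coeff 0 b s / Z * max 0 (Z * cyc_coeff b m (n - s) / cyc_coeff 0 m n - 1))"
proof -
  let ?p = "pmf (cycle_count_pmf n b \<alpha>)" and ?q = "pmf (poisson_vector_pmf b)"
  let ?D = "\<Union>s\<le>n. count_vectors b s"
  let ?g = "\<lambda>s. max 0 (Z * cyc_coeff b m (n - s) / cyc_coeff 0 m n - 1) / Z"
  have Z0: "0 < Z" by (simp add: Z)
  have weight_nonneg: "0 \<le> cauchy_weight b c" for c by (auto simp: cauchy_weight_def intro!: prod_nonneg)
  have "tv_dist (cycle_count_pmf n b \<alpha>) (poisson_vector_pmf b) = infsum (\<lambda>c. max 0 (?p c - ?q c)) ?D"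
    unfolding tv_dist_def
  proof (rule infsum_cong_neutral)
    fix c assume c: "c \<in> UNIV - ?D"
    have "?p c = 0"
    proof (cases "\<forall>x. x \<notin> {1..b} \<longrightarrow> c x = 0")
      case True
      then show ?thesis using c pmf_cycle_count[of \<alpha> n, OF \<alpha> m b True] by (auto simp: count_vectors_def)
    next
      case False
      then show ?thesis unfolding cycle_count_pmf_def by (intro pmf_map_outside) auto
    qed
    then show "max 0 (?p c - ?q c) = 0" by (simp add: pmf_nonneg)
  qed auto
  also have "\<dots> = (\<Sum>c\<in>?D. max 0 (?p c - ?q c))" by (simp add: finite_count_vectors)
  also have "\<dots> = (\<Sum>s\<le>n. \<Sum>c\<in>count_vectors b s. max 0 (?p c - ?q c))"
    by (rule sum.UNION_disjoint) (auto simp: finite_count_vectors, auto simp: count_vectors_def)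
  also have "\<dots> = (\<Sum>s\<le>n. \<Sum>c\<in>count_vectors b s. cauchy_weight b c * ?g s)"
  proof (intro sum.cong refl)
    fix s c assume s: "s \<in> {..n}" and c: "c \<in> count_vectors b s"
    have supp: "\<forall>x. x \<notin> {1..b} \<longrightarrow> c x = 0" and size: "total_size b c = s" using c by (auto simp: count_vectors_def)
    have q: "?q c = cauchy_weight b c / Z" unfolding pmf_poisson_vector Z by (rule if_P[OF supp])
    have "?p c - ?q c = cauchy_weight b c / Z * (Z * cyc_coeff b m (n - s) / cyc_coeff 0 m n - 1)"
      using s Z0 pmf_cycle_count[of \<alpha> n, OF \<alpha> m b supp] size
      by (simp add: q right_diff_distrib)
    then have "max 0 (?p c - ?q c) = max (cauchy_weight b c / Z * 0) (cauchy_weight b c / Z * (Z * cyc_coeff b m (n - s) / cyc_coeff 0 m n - 1))"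
      by simp
    also have "\<dots> = cauchy_weight b c / Z * max 0 (Z * cyc_coeff b m (n - s) / cyc_coeff 0 m n - 1)"
      by (subst max_mult_distrib_left) (simp add: weight_nonneg Z0 less_imp_le)
    finally show "max 0 (?p c - ?q c) = cauchy_weight b c * ?g s" by simp
  qed
  also have "\<dots> = (\<Sum>s\<le>n. cyc_coeff 0 b s * ?g s)" by (simp only: sum_distrib_right[symmetric] sum_cauchy_weight)
  finally show ?thesis by simp
qed

lemma tv_dist_le_1: "tv_dist p q \<le> 1"
proof -
  have "infsum (\<lambda>\<omega>. max 0 (pmf p \<omega> - pmf q \<omega>)) UNIV \<le> infsum (pmf p) UNIV"
    using pmf_has_sum[of p]
    by (intro infsum_mono tv_dist_summable) (auto simp: has_sum_imp_summable pmf_nonneg)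
  also have "\<dots> = 1" using pmf_has_sum[of p] by (simp add: infsumI)
  finally show ?thesis by (simp add: tv_dist_def)
qed

text \<open>
  If the right-hand side is at least \<open>1\<close> there is nothing to show. Otherwise \<open>b * ln n\<close> is
  much smaller than \<open>\<alpha> n\<close>, which in turn is much smaller than \<open>n\<close>, so that \<open>S = \<lfloor>m / ln n\<rfloor>\<close> satisfies
  \<open>b < S\<close> and \<open>m + S < n\<close>. With this choice \<open>(n + m) powr (2 * S / m)\<close> is at most \<open>exp 4\<close>, and
  \<open>b / S\<close> is of order \<open>b * ln n / \<alpha> n\<close>.
\<close>
lemma tv_dist_cycle_count_le:
  assumes n: "3 \<le> n" and \<alpha>: "1 \<le> \<alpha> n" and b: "1 \<le> b"
  shows "tv_dist (cycle_count_pmf n b \<alpha>) (poisson_vector_pmf b)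
    \<le> 16000 * (\<alpha> n / real n + real b * (ln (real n) / \<alpha> n))" (is "?tv \<le> 16000 * (?x + ?y)")
proof -
  have ln1: "1 \<le> ln (real n)"
  proof -
    have "exp 1 \<le> real n" using exp_le n by linarith
    then show ?thesis using n by (simp add: ln_ge_iff)
  qed
  have xy: "0 \<le> ?x" "0 \<le> ?y" using \<alpha> ln1 by auto
  show ?thesis
  proof (cases "1 \<le> 16000 * (?x + ?y)")
    case True
    then show ?thesis using tv_dist_le_1 order_trans by blast
  next
    case False
    then have small: "?x < 1/16000" "?y < 1/16000" using xy by argo+
    define m where "m = nat \<lfloor>\<alpha> n\<rfloor>"
    define S where "S = nat \<lfloor>real m / ln (real n)\<rfloor>"
    define L where "L = ln (real n)"
    have m1: "1 \<le> m" using \<alpha> unfolding m_def by (simp add: le_nat_iff le_floor_iff)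
    have mle: "real m \<le> \<alpha> n" using \<alpha> unfolding m_def by simp
    have m2: "\<alpha> n \<le> 2 * real m"
    proof -
      have "\<alpha> n < real m + 1" using \<alpha> unfolding m_def by linarith
      then show ?thesis using m1 by linarith
    qed
    have "16000 * real b * L < \<alpha> n" using small(2) \<alpha> by (simp add: L_def field_simps)
    then have mL: "8000 * real b * L < real m" using m2 by linarith
    have SL: "real S \<le> real m / L" unfolding S_def L_def using ln1 by simp
    have q1: "8000 * real b < real m / L" using mL ln1 by (simp add: L_def field_simps)
    have "real m / L < real S + 1" unfolding S_def L_def using ln1 by linarith
    then have S2: "real m / L \<le> 2 * real S" and bS: "real b < real S" using q1 b by linarith+
    have "real m / L \<le> real m" using ln1 mult_left_mono[OF ln1, of "real m"] by (simp add: L_def field_simps)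
    then have Sm: "S \<le> m" using SL by linarith
    have "\<alpha> n < real n / 16000" using small(1) n by (simp add: field_simps)
    then have mn: "m + S < n" using mle Sm by linarith
    define K where "K = real (n + m) powr (real (2 * S) / real m)"
    have "K \<le> (real n ^ 2) powr (2 / L)"
      unfolding K_def
    proof (rule powr_mono_both)
      have "real (n + m) \<le> 3 * real n" using mn by simp
      also have "\<dots> \<le> real n ^ 2" using n by (simp add: power2_eq_square)
      finally show "real (n + m) \<le> real n ^ 2" .
      show "real (2 * S) / real m \<le> 2 / L" using SL m1 ln1 by (simp add: L_def field_simps)
    qed (use n in auto)
    \<comment> \<open>The length \<open>S\<close> is chosen such that powers of \<open>n\<close> with exponents of order \<open>S / m\<close> stay bounded.\<close>
    also have "(real n ^ 2) powr (2 / L) = exp 4"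
      using n ln1 by (simp add: powr_def ln_realpow L_def)
    also have "\<dots> = exp 1 ^ 4" by (simp add: exp_of_nat_mult[symmetric])
    also have "\<dots> \<le> 3 ^ 4" by (intro power_mono exp_le) simp
    finally have K: "K \<le> 81" by simp
    have "?tv = (\<Sum>s\<le>n. cyc_coeff 0 b s / exp (\<Sum>j=1..b. 1 / real j) *
        max 0 (exp (\<Sum>j=1..b. 1 / real j) * cyc_coeff b m (n - s) / cyc_coeff 0 m n - 1))"
      by (rule tv_dist_eq[of \<alpha> n, OF \<alpha> m_def _ refl]) (use bS Sm in auto)
    also have "\<dots> \<le> (49 * K + 4) * (real b / real S)"
      by (rule mean_positive_part_le[OF cyc_coeff_sums b _ Sm mn K_def]) (use bS in simp)
    also have "\<dots> \<le> (49 * 81 + 4) * (4 * ?y)"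
    proof (intro mult_mono add_mono mult_left_mono K)
      have "\<alpha> n \<le> 4 * real S * L" using S2 m2 ln1 by (simp add: L_def field_simps)
      then have "real b * \<alpha> n \<le> real b * (4 * real S * L)" by (intro mult_left_mono) auto
      then show "real b / real S \<le> 4 * ?y"
        using bS \<alpha> b by (simp add: L_def field_simps)
    qed (use xy in \<open>auto simp: K_def\<close>)
    also have "\<dots> \<le> 16000 * (?x + ?y)" using xy by argo
    finally show ?thesis .
  qed
qed

theorem theorem2p2:
  fixes a1 a2 :: real and \<alpha> :: "nat \<Rightarrow> real" and b :: "nat \<Rightarrow> nat"
  assumes "0 < a1" and "a1 < 1" and "0 < a2" and "a2 < 1"
    and "\<And>n. 1 \<le> n \<Longrightarrow> real n powr a1 \<le> \<alpha> n \<and> \<alpha> n \<le> real n powr a2"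
    and "\<And>n. 1 \<le> n \<Longrightarrow> 0 < b n"
    and "(\<lambda>n. real (b n)) \<in> o(\<lambda>n. \<alpha> n / ln (real n))"
  shows "\<exists>c::real. \<forall>n\<ge>1.
           tv_dist (cycle_count_pmf n (b n) \<alpha>) (poisson_vector_pmf (b n))
             \<le> c * (\<alpha> n / real n + real (b n) * (ln (real n) / \<alpha> n))"
proof (intro exI allI impI)
  fix n :: nat assume n: "1 \<le> n"
  have \<alpha>: "1 \<le> \<alpha> n"
  proof -
    have "1 \<le> real n powr a1" using n assms(1) by (intro ge_one_powr_ge_zero) auto
    then show ?thesis using assms(5)[OF n] by linarith
  qed
  show "tv_dist (cycle_count_pmf n (b n) \<alpha>) (poisson_vector_pmf (b n))
      \<le> 16000 * (\<alpha> n / real n + real (b n) * (ln (real n) / \<alpha> n))"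
  proof (cases "3 \<le> n")
    case True
    then show ?thesis using \<alpha> assms(6)[OF n] by (intro tv_dist_cycle_count_le) auto
  next
    case False
    \<comment> \<open>For \<open>n \<le> 2\<close> the logarithm may be smaller than \<open>1\<close>, but then \<open>\<alpha> n / n\<close> alone is large enough.\<close>
    have "1 / 2 \<le> \<alpha> n / real n" using False n \<alpha> by (simp add: field_simps)
    moreover have "0 \<le> real (b n) * (ln (real n) / \<alpha> n)" using n \<alpha> by simp
    ultimately have "1 \<le> 16000 * (\<alpha> n / real n + real (b n) * (ln (real n) / \<alpha> n))" by argo
    then show ?thesis using tv_dist_le_1 order_trans by blast
  qed
qed

end
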